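(* Let $\mathcal{G}\subseteq\mathcal{M}_n(\mathbb{C})$ be an irreducible group of matrices. The commutator subgroup $[\mathcal{G},\mathcal{G}]$ consists of involutions if and only if, up to simultaneous similarity, $\mathcal{G}$ is contained in $\mathbb{C}^\times\mathcal{H}$, where $\mathcal{H}$ is a signed permutation group with commutative pattern (that is, there are an invertible $X\in\mathcal{M}_n(\mathbb{C})$ and such a group $\mathcal{H}\subseteq\mathcal{M}_n(\mathbb{C})$ with $X^{-1}\mathcal{G}X\subseteq\mathbb{C}^\times\mathcal{H}=\{\lambda H:\lambda\in\mathbb{C}^\times, H\in\mathcal{H}\}$).
   Context: $\mathcal{M}_n(\mathbb{C})$ is the algebra of $n\times n$ complex matrices and $\mathbb{C}^\times=\mathbb{C}\setminus\{0\}$. A group of matrices means a group of invertible matrices under multiplication. Irreducible means having no common invariant subspace of $\mathbb{C}^n$ other than $\{0\}$ and $\mathbb{C}^n$. $[\mathcal{G},\mathcal{G}]$ is the subgroup generated by all group commutators $ABA^{-1}B^{-1}$, $A,B\in\mathcal{G}$. An involution is a matrix $J$ with $J^2=I$ (the identity is included). A signed permutation is a matrix with exactly one nonzero entry in each row and each column, all of whose nonzero entries lie in $\{1,-1\}$; a signed permutation group is a matrix group consisting of signed permutations. The pattern of such a matrix is the permutation matrix obtained by replacing each nonzero entry by $1$; a group has commutative pattern if the set (group) of patterns of its members is commutative. *)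

theory Defs
  imports "HOL-Analysis.Analysis" "HOL-Algebra.Generated_Groups"
begin

definition GL :: "(complex^'n^'n) monoid" where
  "GL = \<lparr>carrier = {A. invertible A}, monoid.mult = (**), one = mat 1\<rparr>"

lemma group_GL: "group (GL :: (complex^'n^'n) monoid)"
proof (rule groupI)
  fix A :: "complex^'n^'n"
  assume "A \<in> carrier GL"
  then obtain B where "A ** B = mat 1" "B ** A = mat 1"
    unfolding GL_def invertible_def by auto
  then show "\<exists>B\<in>carrier GL. B \<otimes>\<^bsub>GL\<^esub> A = \<one>\<^bsub>GL\<^esub>"
    unfolding GL_def invertible_def by auto
next
  show "\<one>\<^bsub>GL\<^esub> \<in> carrier (GL :: (complex^'n^'n) monoid)"
    unfolding GL_def invertible_def by (auto intro: exI[of _ "mat 1"])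
qed (simp_all add: GL_def invertible_mult matrix_mul_assoc)

lemma inv_GL:
  fixes A :: "complex^'n^'n"
  assumes "invertible A"
  shows "inv\<^bsub>GL\<^esub> A = matrix_inv A"
proof -
  have "A ** matrix_inv A = mat 1 \<and> matrix_inv A ** A = mat 1"
    using assms unfolding invertible_def matrix_inv_def by (rule someI_ex)
  then show ?thesis
    using assms by (intro group.inv_equality[OF group_GL]) (auto simp: GL_def invertible_def)
qed

definition irreducible_matrices :: "(complex^'n^'n) set \<Rightarrow> bool" where
  "irreducible_matrices S \<longleftrightarrow>
     (\<forall>W :: (complex^'n) set.
        vec.subspace W \<and> (\<forall>A\<in>S. \<forall>w\<in>W. A *v w \<in> W) \<longrightarrow> W = {0} \<or> W = UNIV)"

definition matrix_involution :: "complex^'n^'n \<Rightarrow> bool" where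
  "matrix_involution J \<longleftrightarrow> J ** J = mat 1"

definition signed_permutation :: "complex^'n^'n \<Rightarrow> bool" where
  "signed_permutation A \<longleftrightarrow>
     (\<forall>i. \<exists>!j. A $ i $ j \<noteq> 0) \<and> (\<forall>j. \<exists>!i. A $ i $ j \<noteq> 0) \<and>
     (\<forall>i j. A $ i $ j \<noteq> 0 \<longrightarrow> A $ i $ j \<in> {1, -1})"

definition signed_permutation_group :: "(complex^'n^'n) set \<Rightarrow> bool" where
  "signed_permutation_group H \<longleftrightarrow> subgroup H GL \<and> (\<forall>A\<in>H. signed_permutation A)"

definition pattern :: "complex^'n^'n \<Rightarrow> complex^'n^'n" where
  "pattern A = (\<chi> i j. if A $ i $ j = 0 then 0 else 1)"

definition commutative_pattern :: "(complex^'n^'n) set \<Rightarrow> bool" where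
  "commutative_pattern H \<longleftrightarrow>
     (\<forall>P\<in>pattern ` H. \<forall>Q\<in>pattern ` H. P ** Q = Q ** P)"

text \<open>The operator \<open>*s\<close> scales vectors only, so the scalar multiple of a matrix
  is written entrywise.\<close>

definition nonzero_multiples :: "(complex^'n^'n) set \<Rightarrow> (complex^'n^'n) set" where
  "nonzero_multiples H = {(\<chi> i j. c * A $ i $ j) | c A. c \<noteq> 0 \<and> A \<in> H}"

end

theory Submission
  imports Defs "HOL-Computational_Algebra.Fundamental_Theorem_Algebra"
begin

text \<open>
  If \<open>G\<close> is, up to scalars and a change of basis, a group of signed permutations with commuting
  patterns, then its commutators have trivial pattern, so they are simultaneously diagonalizable with eigenvalues
  \<open>1\<close> and \<open>-1\<close>. They generate a group of involutions; see \<open>derived_involutions_of_signed_form\<close>.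

  Conversely let \<open>D = [G, G]\<close> consist of involutions, so that \<open>D\<close> is abelian. Pass to
  the group \<open>K\<close> of all nonzero multiples of elements of \<open>G\<close>, which has the same commutators. Choose a
  maximal abelian subgroup \<open>A\<close> of \<open>K\<close> containing \<open>D\<close>; it is normal in \<open>K\<close>. It has a common
  eigenvector \<open>v\<close>, with weight \<open>\<lambda>\<close> say. The key point is that the stabilizer of
  \<open>\<lambda>\<close> in \<open>K\<close> is \<open>A\<close> itself (\<open>weight_stabilizer_in_self_centralizing\<close>). Hence vectors
  \<open>g v\<close> for \<open>g\<close> from different cosets of \<open>A\<close> have different weights under \<open>A\<close> and are independent, while they span
  the space by irreducibility: the coset lines form a system of coordinate axes permuted by \<open>K\<close>,
  through the abelian group \<open>K / A\<close>.

  It remains to get rid of the scalars that occur when the axes are permuted. Let \<open>B\<close> be the subgroup of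
  those \<open>a\<close> in \<open>A\<close> with \<open>\<lambda>(a) = 1\<close> or \<open>\<lambda>(a) = -1\<close>. It contains \<open>D\<close>, because elements of \<open>D\<close> are
  involutions, so \<open>K / B\<close> is abelian. The scalars are divisible, so they split off modulo \<open>B\<close>
  (\<open>divisible_central_supplement\<close>): \<open>K\<close> is the product of the scalars and a subgroup \<open>H\<close>
  that contains \<open>B\<close> and whose only scalars are \<open>1\<close> and \<open>-1\<close>. Then \<open>H\<close> meets \<open>A\<close> in \<open>B\<close>, so the orbit of \<open>v\<close>
  under \<open>H\<close> meets every axis in exactly two opposite vectors, and in the resulting basis \<open>H\<close> acts by signed
  permutations. Elements of \<open>D\<close> are diagonal in this basis, so patterns commute.
\<close>

section \<open>Central divisible subgroups have supplements\<close>

lemma (in group) subgroup_Union_chain: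
  assumes "C \<noteq> {}" "\<And>H. H \<in> C \<Longrightarrow> subgroup H G"
    and "\<And>H I. H \<in> C \<Longrightarrow> I \<in> C \<Longrightarrow> H \<subseteq> I \<or> I \<subseteq> H"
  shows "subgroup (\<Union>C) G"
proof (rule subgroupI)
  show "\<Union>C \<subseteq> carrier G"
    using assms(2) subgroup.subset by blast
  show "\<Union>C \<noteq> {}"
    using assms(1,2) subgroup.one_closed by blast
next
  fix x assume "x \<in> \<Union>C"
  then show "inv x \<in> \<Union>C"
    using assms(2) subgroup.m_inv_closed by fast
next
  fix x y assume "x \<in> \<Union>C" "y \<in> \<Union>C"
  then obtain H I where "H \<in> C" "x \<in> H" "I \<in> C" "y \<in> I" by blast
  then obtain H where "H \<in> C" "x \<in> H" "y \<in> H"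
    using assms(3)[of H I] by blast
  then show "x \<otimes> y \<in> \<Union>C"
    using subgroup.m_closed[OF assms(2)] by fast
qed

text \<open>Since commutators of \<open>K\<close> lie in \<open>H\<close>, elements of \<open>K\<close> can be reordered at the cost of a factor
from \<open>H\<close>. So adjoining \<open>g\<close> to \<open>H\<close> only adds the products \<open>h g\<^sup>j\<close>.\<close>

lemma (in group) subgroup_mult_cyclic:
  assumes H: "subgroup H G" and K: "subgroup K G" "H \<subseteq> K" and g: "g \<in> K"
    and comm: "\<And>x y. x \<in> K \<Longrightarrow> y \<in> K \<Longrightarrow> x \<otimes> y \<otimes> inv x \<otimes> inv y \<in> H"
  shows "subgroup {h \<otimes> g [^] j |h j :: int. h \<in> H} G"
proof -
  have c: "x \<in> carrier G" if "x \<in> K" for x using that K subgroup.subset by blast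
  have gp: "g [^] j \<in> K" for j :: int
    using K g by (simp add: subgroup_int_pow_closed)
  have swap: "\<exists>h'\<in>H. x \<otimes> y = h' \<otimes> (y \<otimes> x)" if "x \<in> K" "y \<in> K" for x y
  proof -
    have "inv y \<otimes> (y \<otimes> x) = x" using that c by (simp add: m_assoc[symmetric])
    then have "x \<otimes> y = (x \<otimes> y \<otimes> inv x \<otimes> inv y) \<otimes> (y \<otimes> x)" using that c by (simp add: m_assoc)
    then show ?thesis using comm[OF that] by blast
  qed
  show ?thesis
  proof (rule subgroupI)
    show "{h \<otimes> g [^] j |h j :: int. h \<in> H} \<subseteq> carrier G"
      using c gp K by (auto intro!: m_closed)
    show "{h \<otimes> g [^] j |h j :: int. h \<in> H} \<noteq> {}"
      using H subgroup.one_closed by blast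
  next
    fix x assume "x \<in> {h \<otimes> g [^] j |h j :: int. h \<in> H}"
    then obtain h j where x: "x = h \<otimes> g [^] (j::int)" "h \<in> H" by blast
    have "inv x = g [^] (-j) \<otimes> inv h"
      using x c gp K g by (auto simp: inv_mult_group int_pow_neg)
    moreover have ih: "inv h \<in> H" using x(2) subgroup.m_inv_closed[OF H] by blast
    moreover from ih have "inv h \<in> K" using K(2) by blast
    then obtain h' where h': "h' \<in> H" "g [^] (-j) \<otimes> inv h = h' \<otimes> (inv h \<otimes> g [^] (-j))"
      using swap[OF gp] by blast
    moreover have "h' \<in> carrier G" "inv h \<in> carrier G" "g [^] (-j) \<in> carrier G"
      using h'(1) ih gp c K(2) by blast+
    ultimately have "inv x = (h' \<otimes> inv h) \<otimes> g [^] (-j)"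
      by (simp only: m_assoc)
    moreover have "h' \<otimes> inv h \<in> H" using h'(1) ih by (rule subgroup.m_closed[OF H])
    ultimately show "inv x \<in> {h \<otimes> g [^] j |h j :: int. h \<in> H}" by blast
  next
    fix x y assume "x \<in> {h \<otimes> g [^] j |h j :: int. h \<in> H}" "y \<in> {h \<otimes> g [^] j |h j :: int. h \<in> H}"
    then obtain h j k i where x: "x = h \<otimes> g [^] (j::int)" "h \<in> H" "y = k \<otimes> g [^] (i::int)" "k \<in> H"
      by blast
    obtain h' where h': "h' \<in> H" "g [^] j \<otimes> k = h' \<otimes> (k \<otimes> g [^] j)"
      using swap[OF gp subsetD[OF K(2) x(4)]] by blast
    have in_c: "h \<in> carrier G" "k \<in> carrier G" "h' \<in> carrier G" "g \<in> carrier G"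
      using x(2,4) h'(1) c K(2) g by blast+
    then have "x \<otimes> y = h \<otimes> (g [^] j \<otimes> k) \<otimes> g [^] i"
      unfolding x(1,3) by (simp add: m_assoc)
    also have "\<dots> = (h \<otimes> h' \<otimes> k) \<otimes> g [^] (j + i)"
      unfolding h'(2) using in_c by (simp add: m_assoc int_pow_mult)
    finally have "x \<otimes> y = (h \<otimes> h' \<otimes> k) \<otimes> g [^] (j + i)" .
    moreover have "h \<otimes> h' \<otimes> k \<in> H"
      using x(2,4) h'(1) by (intro subgroup.m_closed[OF H])
    ultimately show "x \<otimes> y \<in> {h \<otimes> g [^] j |h j :: int. h \<in> H}"
      by blast
  qed
qed

text \<open>Modulo \<open>B\<close> the group \<open>K\<close> is abelian and the image of \<open>C\<close> is divisible, hence a direct summand; the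
preimage of a complement is the required \<open>H\<close>. The proof carries out this splitting without forming
the quotient: a maximal \<open>H\<close> with \<open>B \<subseteq> H\<close> and \<open>H \<inter> C \<subseteq> B\<close> must satisfy \<open>K = C H\<close>, because any
\<open>g\<close> outside \<open>C H\<close> could be corrected, if necessary, by an element of \<open>C\<close> and then adjoined to \<open>H\<close>. Divisibility
supplies the correction.\<close>

lemma (in group) divisible_central_supplement:
  assumes K: "subgroup K G" and B: "subgroup B G" "B \<subseteq> K" and C: "subgroup C G" "C \<subseteq> K"
    and central: "\<And>c x. c \<in> C \<Longrightarrow> x \<in> K \<Longrightarrow> c \<otimes> x = x \<otimes> c"
    and divisible: "\<And>c k. c \<in> C \<Longrightarrow> (k::nat) > 0 \<Longrightarrow> \<exists>d\<in>C. d [^] k = c"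
    and comm: "\<And>x y. x \<in> K \<Longrightarrow> y \<in> K \<Longrightarrow> x \<otimes> y \<otimes> inv x \<otimes> inv y \<in> B"
  obtains H where "subgroup H G" "B \<subseteq> H" "H \<subseteq> K" "H \<inter> C \<subseteq> B"
    "\<And>g. g \<in> K \<Longrightarrow> \<exists>c\<in>C. \<exists>h\<in>H. g = c \<otimes> h"
proof -
  define F where "F = {H. subgroup H G \<and> B \<subseteq> H \<and> H \<subseteq> K \<and> H \<inter> C \<subseteq> B}"
  have "\<exists>M\<in>F. \<forall>Z\<in>F. M \<subseteq> Z \<longrightarrow> Z = M"
  proof (rule subset_Zorn_nonempty)
    show "F \<noteq> {}" using B unfolding F_def by blast
    fix Ch assume Ch: "Ch \<noteq> {}" "subset.chain F Ch"
    have "subgroup (\<Union>Ch) G"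
      by (rule subgroup_Union_chain) (use Ch in \<open>auto simp: subset_chain_def F_def\<close>)
    then show "\<Union>Ch \<in> F"
      using Ch unfolding F_def subset_chain_def by blast
  qed
  then obtain H where "H \<in> F" and max: "\<And>Z. Z \<in> F \<Longrightarrow> H \<subseteq> Z \<Longrightarrow> Z = H" by blast
  then have H: "subgroup H G" "B \<subseteq> H" "H \<subseteq> K" "H \<inter> C \<subseteq> B" unfolding F_def by auto
  have car: "x \<in> carrier G" if "x \<in> K" for x using that K subgroup.subset by blast
  have carC: "x \<in> carrier G" if "x \<in> C" for x using that C car by blast
  have carH: "x \<in> carrier G" if "x \<in> H" for x using that H car by blast
  \<comment> \<open>Maximality in usable form: an element that can be adjoined without creating new elements of \<open>C\<close>
    already lies in \<open>H\<close>.\<close>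
  have adjoin: "g \<in> H" if g: "g \<in> K"
    and "\<And>h j. h \<in> H \<Longrightarrow> h \<otimes> g [^] (j::int) \<in> C \<Longrightarrow> h \<otimes> g [^] j \<in> B" for g
  proof -
    let ?E = "{h \<otimes> g [^] j |h j :: int. h \<in> H}"
    have "subgroup ?E G"
      using comm H by (intro subgroup_mult_cyclic[OF H(1) K H(3) g]) blast
    moreover have sub: "H \<subseteq> ?E"
    proof
      fix h assume "h \<in> H"
      then have "h = h \<otimes> g [^] (0::int)" using carH by simp
      then show "h \<in> ?E" using \<open>h \<in> H\<close> by blast
    qed
    moreover have "?E \<subseteq> K"
      using H(3) subgroup.m_closed[OF K] subgroup_int_pow_closed[OF K g] by blast
    ultimately have "?E \<in> F" using that H unfolding F_def by blast
    then have "?E = H" using max sub by blast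
    moreover have "g = \<one> \<otimes> g [^] (1::int)" using car[OF g] by simp
    ultimately show "g \<in> H" using H(1) subgroup.one_closed by blast
  qed
  define S where "S = {c \<otimes> h |c h. c \<in> C \<and> h \<in> H}"
  have SI: "c \<otimes> h \<in> S" if "c \<in> C" "h \<in> H" for c h
    using that unfolding S_def by blast
  have S: "subgroup S G"
  proof (rule subgroupI)
    show "S \<subseteq> carrier G" unfolding S_def using carC carH by auto
    show "S \<noteq> {}" unfolding S_def using subgroup.one_closed[OF C(1)] subgroup.one_closed[OF H(1)] by blast
  next
    fix x assume "x \<in> S"
    then obtain c h where x: "x = c \<otimes> h" "c \<in> C" "h \<in> H" unfolding S_def by blast
    have ic: "inv c \<in> C" and ih: "inv h \<in> H"
      using subgroup.m_inv_closed[OF C(1) x(2)] subgroup.m_inv_closed[OF H(1) x(3)] .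
    have "inv x = inv h \<otimes> inv c" using x carC carH by (simp add: inv_mult_group)
    also have "\<dots> = inv c \<otimes> inv h"
      using central[OF ic] ih H(3) by (simp add: subset_iff)
    finally show "inv x \<in> S"
      using SI[OF ic ih] by simp
  next
    fix x y assume "x \<in> S" "y \<in> S"
    then obtain c h d k where x: "x = c \<otimes> h" "c \<in> C" "h \<in> H" "y = d \<otimes> k" "d \<in> C" "k \<in> H"
      unfolding S_def by blast
    have "x \<otimes> y = c \<otimes> (h \<otimes> d) \<otimes> k" using x carC carH by (simp add: m_assoc)
    also have "h \<otimes> d = d \<otimes> h" using central[OF x(5)] x(3) H(3) by (simp add: subset_iff)
    finally have "x \<otimes> y = (c \<otimes> d) \<otimes> (h \<otimes> k)" using x(2,3,5,6) carC carH by (simp add: m_assoc)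
    then show "x \<otimes> y \<in> S"
      using SI[OF subgroup.m_closed[OF C(1) x(2,5)] subgroup.m_closed[OF H(1) x(3,6)]] by simp
  qed
  have HS: "H \<subseteq> S"
  proof
    fix h assume "h \<in> H"
    then show "h \<in> S" using SI[OF subgroup.one_closed[OF C(1)], of h] carH by simp
  qed
  have CS: "C \<subseteq> S"
  proof
    fix c assume "c \<in> C"
    then show "c \<in> S" using SI[OF _ subgroup.one_closed[OF H(1)], of c] carC by simp
  qed
  have powS: "g [^] j \<in> S" if "g \<in> K" "h \<in> H" "h \<otimes> g [^] (j::int) \<in> C" for g h j
  proof -
    have "g [^] j = inv h \<otimes> (h \<otimes> g [^] j)" using that car carH by (simp add: m_assoc[symmetric])
    moreover have "inv h \<in> S" "h \<otimes> g [^] j \<in> S"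
      using that(2,3) HS CS subgroup.m_inv_closed[OF S] by blast+
    ultimately show ?thesis
      by (metis subgroup.m_closed[OF S])
  qed
  show thesis
  proof (rule that[OF H])
    fix g assume g: "g \<in> K"
    show "\<exists>c\<in>C. \<exists>h\<in>H. g = c \<otimes> h"
    proof (cases "\<exists>k::nat. k > 0 \<and> g [^] k \<in> S")
      \<comment> \<open>No nontrivial power of \<open>g\<close> lies in \<open>C H\<close>, so adjoining \<open>g\<close> itself creates nothing new in \<open>C\<close>.\<close>
      case False
      have "j = 0" if "g [^] (j::int) \<in> S" for j
      proof (rule ccontr)
        assume "j \<noteq> 0"
        have "g [^] nat \<bar>j\<bar> \<in> S"
        proof (cases "j < 0")
          case True
          have "g [^] (-j) \<in> S"
            using subgroup.m_inv_closed[OF S that] car[OF g] by (simp add: int_pow_neg)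
          then show ?thesis using True by (simp add: int_pow_int[symmetric])
        next
          case False
          then show ?thesis using that by (simp add: int_pow_int[symmetric])
        qed
        then show False using False \<open>j \<noteq> 0\<close> by (metis zero_less_abs_iff zero_less_nat_eq)
      qed
      then have "h \<otimes> g [^] j \<in> B" if "h \<in> H" "h \<otimes> g [^] j \<in> C" for h and j :: int
        using that powS[OF g that] H(4) carH by fastforce
      then have "g \<in> H" by (rule adjoin[OF g])
      then have "g \<in> S" using HS by blast
      then show ?thesis unfolding S_def by blast
    next
      case True
      then obtain k :: nat where k: "k > 0" "g [^] k \<in> S"
        and least: "\<And>i :: nat. i < k \<Longrightarrow> \<not> (i > 0 \<and> g [^] i \<in> S)"
        using exists_least_iff[of "\<lambda>k::nat. k > 0 \<and> g [^] k \<in> S"] by blast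
      obtain c h where ch: "c \<in> C" "h \<in> H" "g [^] k = c \<otimes> h" using k(2) unfolding S_def by blast
      obtain d where d: "d \<in> C" "d [^] k = c" using divisible[OF ch(1) k(1)] by blast
      have id: "inv d \<in> C" using subgroup.m_inv_closed[OF C(1) d(1)] .
      \<comment> \<open>Dividing by a \<open>k\<close>-th root of the central part \<open>c\<close> of \<open>g\<^sup>k\<close> moves the \<open>k\<close>-th power into \<open>H\<close>.\<close>
      define g' where "g' = inv d \<otimes> g"
      have g': "g' \<in> K" unfolding g'_def using subgroup.m_closed[OF K _ g] id C(2) by blast
      have pow: "g' [^] j = inv d [^] j \<otimes> g [^] j" for j :: int
        unfolding g'_def by (rule int_pow_mult_distrib[OF central[OF id g] carC[OF id] car[OF g]])
      have "inv d [^] k = inv c"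
        using nat_pow_inv[OF carC[OF d(1)], of k] d(2) by simp
      then have "g' [^] k = inv c \<otimes> (c \<otimes> h)"
        using pow[of "int k"] ch(3) by (simp add: int_pow_int)
      also have "\<dots> = h"
        using carC[OF ch(1)] carH[OF ch(2)] by (simp add: m_assoc[symmetric])
      finally have g'k: "g' [^] k \<in> H" using ch(2) by simp
      have "g' \<in> H"
      proof (rule adjoin[OF g'])
        fix h' j assume h': "h' \<in> H" "h' \<otimes> g' [^] (j::int) \<in> C"
        have "g [^] j = d [^] j \<otimes> g' [^] j"
          unfolding pow using carC[OF d(1)] car[OF g] by (simp add: m_assoc[symmetric] int_pow_inv)
        moreover have "d [^] j \<in> S" using d(1) CS by (intro subgroup_int_pow_closed[OF S]) blast
        ultimately have gj: "g [^] j \<in> S"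
          using subgroup.m_closed[OF S _ powS[OF g' h']] by simp
        \<comment> \<open>Minimality of \<open>k\<close> forces \<open>k\<close> to divide \<open>j\<close>, so this power of \<open>g'\<close> is a power of \<open>g'\<^sup>k\<close>.\<close>
        define r where "r = nat (j mod int k)"
        have r: "int r = j mod int k" "r < k"
          using k(1) unfolding r_def by (auto simp: nat_less_iff)
        have "g [^] int r = g [^] j \<otimes> inv (g [^] int k) [^] (j div int k)"
        proof -
          have "int r = j + (- int k) * (j div int k)"
            unfolding r(1) using mult_div_mod_eq[of "int k" j] by (simp add: algebra_simps)
          then have "g [^] int r = g [^] j \<otimes> g [^] ((- int k) * (j div int k))"
            using int_pow_mult[OF car[OF g]] by metis
          also have "g [^] ((- int k) * (j div int k)) = inv (g [^] int k) [^] (j div int k)"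
            by (simp only: int_pow_pow[OF car[OF g], symmetric] int_pow_neg[OF car[OF g]])
          finally show ?thesis .
        qed
        moreover have "inv (g [^] int k) [^] (j div int k) \<in> S"
          using subgroup_int_pow_closed[OF S subgroup.m_inv_closed[OF S k(2)]] by (simp only: int_pow_int)
        ultimately have "g [^] r \<in> S"
          using subgroup.m_closed[OF S gj] by (metis int_pow_int)
        then have "r = 0" using least[OF r(2)] by simp
        then have "j = int k * (j div int k)" using r(1) mult_div_mod_eq[of "int k" j] by linarith
        then have "g' [^] j = (g' [^] k) [^] (j div int k)"
          using int_pow_pow[OF car[OF g'], of "int k" "j div int k"] by (simp only: int_pow_int)
        then have "g' [^] j \<in> H" using subgroup_int_pow_closed[OF H(1) g'k] by simp
        then have "h' \<otimes> g' [^] j \<in> H" by (rule subgroup.m_closed[OF H(1) h'(1)])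
        with h'(2) H(4) show "h' \<otimes> g' [^] j \<in> B"
          by (meson IntI subsetD)
      qed
      moreover have "g = d \<otimes> g'"
        unfolding g'_def using carC[OF d(1)] car[OF g] by (simp add: m_assoc[symmetric])
      ultimately show ?thesis using d(1) by blast
    qed
  qed
qed

section \<open>Commutators and self-centralizing subgroups\<close>

text \<open>Together with associativity and the rule for inverses of products, these identities let the
simplifier decide equations that hold in every group.\<close>

lemma (in group) cancel_left:
  assumes "x \<in> carrier G" "y \<in> carrier G"
  shows "inv x \<otimes> (x \<otimes> y) = y" and "x \<otimes> (inv x \<otimes> y) = y"
  using assms by (simp_all add: m_assoc[symmetric])

lemma (in group) commutator_eqI:
  assumes "x \<in> carrier G" "y \<in> carrier G" "c \<in> carrier G" "x \<otimes> y = c \<otimes> (y \<otimes> x)"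
  shows "x \<otimes> y \<otimes> inv x \<otimes> inv y = c"
  using assms by (simp add: m_assoc)

lemma (in group) commutator_swap:
  assumes "x \<in> carrier G" "y \<in> carrier G"
  shows "(x \<otimes> y \<otimes> inv x \<otimes> inv y) \<otimes> (y \<otimes> x) = x \<otimes> y"
  using assms by (simp add: m_assoc cancel_left)

lemma (in group) conjugate_subgroup:
  assumes x: "x \<in> carrier G" and H: "subgroup H G"
  shows "subgroup ((\<lambda>h. x \<otimes> h \<otimes> inv x) ` H) G"
proof (rule subgroupI)
  have c: "h \<in> carrier G" if "h \<in> H" for h using subgroup.mem_carrier[OF H that] .
  show "(\<lambda>h. x \<otimes> h \<otimes> inv x) ` H \<subseteq> carrier G"
    using c x by auto
  show "(\<lambda>h. x \<otimes> h \<otimes> inv x) ` H \<noteq> {}"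
    using subgroup.one_closed[OF H] by auto
  fix a assume "a \<in> (\<lambda>h. x \<otimes> h \<otimes> inv x) ` H"
  then obtain h where h: "a = x \<otimes> h \<otimes> inv x" "h \<in> H" by auto
  have "inv a = x \<otimes> inv h \<otimes> inv x"
    unfolding h(1) using c[OF h(2)] x by (simp add: inv_mult_group m_assoc)
  then show "inv a \<in> (\<lambda>h. x \<otimes> h \<otimes> inv x) ` H"
    using subgroup.m_inv_closed[OF H h(2)] by simp
  fix b assume "b \<in> (\<lambda>h. x \<otimes> h \<otimes> inv x) ` H"
  then obtain k where k: "b = x \<otimes> k \<otimes> inv x" "k \<in> H" by auto
  have "a \<otimes> b = x \<otimes> (h \<otimes> k) \<otimes> inv x"
    unfolding h(1) k(1) using c[OF h(2)] c[OF k(2)] x by (simp add: m_assoc cancel_left)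
  then show "a \<otimes> b \<in> (\<lambda>h. x \<otimes> h \<otimes> inv x) ` H"
    using subgroup.m_closed[OF H h(2) k(2)] by simp
qed

lemma (in group) conjugate_of_commutator:
  assumes "x \<in> carrier G" "h \<in> carrier G" "k \<in> carrier G"
  shows "x \<otimes> (h \<otimes> k \<otimes> inv h \<otimes> inv k) \<otimes> inv x =
    (x \<otimes> h \<otimes> inv x) \<otimes> (x \<otimes> k \<otimes> inv x) \<otimes> inv (x \<otimes> h \<otimes> inv x) \<otimes> inv (x \<otimes> k \<otimes> inv x)"
  using assms by (simp add: m_assoc inv_mult_group cancel_left)

lemma (in group) conjugate_in_commutator_closed:
  assumes K: "subgroup K G" and A: "subgroup A G" "A \<subseteq> K"
    and comm: "\<And>x y. x \<in> K \<Longrightarrow> y \<in> K \<Longrightarrow> x \<otimes> y \<otimes> inv x \<otimes> inv y \<in> A"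
    and g: "g \<in> K" and a: "a \<in> A"
  shows "inv g \<otimes> a \<otimes> g \<in> A"
proof -
  have c: "g \<in> carrier G" "a \<in> carrier G"
    using subgroup.mem_carrier[OF K g] subgroup.mem_carrier[OF A(1) a] .
  have "inv g \<otimes> a \<otimes> inv (inv g) \<otimes> inv a \<in> A"
    using comm subgroup.m_inv_closed[OF K g] a A(2) by (meson subsetD)
  then have "(inv g \<otimes> a \<otimes> g \<otimes> inv a) \<otimes> a \<in> A"
    using subgroup.m_closed[OF A(1) _ a] c by simp
  then show ?thesis using c by (simp add: m_assoc)
qed

text \<open>Modulo the abelian group \<open>A\<close>, conjugation by \<open>h\<close> does not move \<open>g\<close>, so it turns a commutator of \<open>g\<close>
with \<open>A\<close> into another such commutator, with the same \<open>g\<close>.\<close>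

lemma (in group) conjugate_commutator:
  assumes K: "subgroup K G" and A: "subgroup A G" "A \<subseteq> K"
    and abelian: "\<And>x y. x \<in> A \<Longrightarrow> y \<in> A \<Longrightarrow> x \<otimes> y = y \<otimes> x"
    and comm: "\<And>x y. x \<in> K \<Longrightarrow> y \<in> K \<Longrightarrow> x \<otimes> y \<otimes> inv x \<otimes> inv y \<in> A"
    and g: "g \<in> K" and h: "h \<in> K" and a: "a \<in> A"
  obtains a' where "a' \<in> A"
    "inv h \<otimes> (g \<otimes> a \<otimes> inv g \<otimes> inv a) \<otimes> h = g \<otimes> a' \<otimes> inv g \<otimes> inv a'"
proof -
  define a' where "a' = inv h \<otimes> a \<otimes> h"
  define d where "d = inv g \<otimes> inv h \<otimes> g \<otimes> h"
  have a': "a' \<in> A"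
    unfolding a'_def by (rule conjugate_in_commutator_closed[OF K A comm h a])
  have c: "g \<in> carrier G" "h \<in> carrier G" "a \<in> carrier G" "a' \<in> carrier G"
    using subgroup.mem_carrier[OF K g] subgroup.mem_carrier[OF K h]
      subgroup.mem_carrier[OF A(1) a] subgroup.mem_carrier[OF A(1) a'] .
  have d: "d \<in> A"
    using comm[OF subgroup.m_inv_closed[OF K g] subgroup.m_inv_closed[OF K h]] c by (simp add: d_def)
  have dc: "d \<in> carrier G" using subgroup.mem_carrier[OF A(1) d] .
  have "inv h \<otimes> (g \<otimes> a \<otimes> inv g \<otimes> inv a) \<otimes> h = (g \<otimes> d) \<otimes> a' \<otimes> inv (g \<otimes> d) \<otimes> inv a'"
    unfolding a'_def d_def using c by (simp add: m_assoc inv_mult_group cancel_left)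
  also have "\<dots> = g \<otimes> (d \<otimes> a') \<otimes> inv d \<otimes> inv g \<otimes> inv a'"
    using c dc by (simp add: m_assoc inv_mult_group)
  \<comment> \<open>Conjugation replaces \<open>g\<close> by \<open>g d\<close>, and \<open>d\<close> drops out because it commutes with \<open>a'\<close>.\<close>
  also have "d \<otimes> a' = a' \<otimes> d" using abelian[OF d a'] .
  also have "g \<otimes> (a' \<otimes> d) \<otimes> inv d \<otimes> inv g \<otimes> inv a' = g \<otimes> a' \<otimes> inv g \<otimes> inv a'"
    using c dc by (simp add: m_assoc cancel_left)
  finally show thesis using that a' by blast
qed

text \<open>Maximality of a commuting set is a statement about single elements: whatever commutes with the
whole set belongs to it.\<close>

lemma maximal_commuting_superset:
  fixes mul :: "'a \<Rightarrow> 'a \<Rightarrow> 'a"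
  assumes "D \<subseteq> K" and "\<And>x y. x \<in> D \<Longrightarrow> y \<in> D \<Longrightarrow> mul x y = mul y x"
  obtains A where "D \<subseteq> A" "A \<subseteq> K" "\<And>x y. x \<in> A \<Longrightarrow> y \<in> A \<Longrightarrow> mul x y = mul y x"
    "\<And>g. g \<in> K \<Longrightarrow> (\<And>a. a \<in> A \<Longrightarrow> mul g a = mul a g) \<Longrightarrow> g \<in> A"
proof -
  define F where "F = {A. D \<subseteq> A \<and> A \<subseteq> K \<and> (\<forall>x\<in>A. \<forall>y\<in>A. mul x y = mul y x)}"
  have "\<exists>M\<in>F. \<forall>Z\<in>F. M \<subseteq> Z \<longrightarrow> Z = M"
  proof (rule subset_Zorn_nonempty)
    show "F \<noteq> {}"
      using assms unfolding F_def by blast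
    fix C assume C: "C \<noteq> {}" "subset.chain F C"
    show "\<Union>C \<in> F"
      unfolding F_def
    proof (intro CollectI conjI ballI)
      fix x y assume "x \<in> \<Union>C" "y \<in> \<Union>C"
      then obtain U V where "U \<in> C" "V \<in> C" "x \<in> U" "y \<in> V" by blast
      then obtain W where "W \<in> C" "x \<in> W" "y \<in> W"
        using subset_chain_def C by (metis subsetD)
      then show "mul x y = mul y x"
        using C unfolding subset_chain_def F_def by blast
    qed (use C in \<open>(fastforce simp: subset_chain_def F_def)+\<close>)
  qed
  then obtain A where A: "A \<in> F" and max: "\<And>Z. Z \<in> F \<Longrightarrow> A \<subseteq> Z \<Longrightarrow> Z = A" by blast
  show thesis
  proof (rule that)
    fix g assume "g \<in> K" "\<And>a. a \<in> A \<Longrightarrow> mul g a = mul a g"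
    then have "insert g A \<in> F"
      using A unfolding F_def by auto
    from max[OF this] show "g \<in> A" by blast
  qed (use A in \<open>auto simp: F_def\<close>)
qed

lemma (in group) self_centralizing_subgroup:
  assumes K: "subgroup K G" and A: "A \<subseteq> K"
    and abelian: "\<And>x y. x \<in> A \<Longrightarrow> y \<in> A \<Longrightarrow> x \<otimes> y = y \<otimes> x"
    and maximal: "\<And>g. g \<in> K \<Longrightarrow> (\<And>a. a \<in> A \<Longrightarrow> g \<otimes> a = a \<otimes> g) \<Longrightarrow> g \<in> A"
  shows "subgroup A G"
proof -
  have c: "x \<in> carrier G" if "x \<in> A" for x
    using subgroup.mem_carrier[OF K] A that by blast
  have AK: "x \<in> K" if "x \<in> A" for x using A that by blast
  have one: "\<one> \<in> A"
    using maximal[OF subgroup.one_closed[OF K]] c by simp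
  show ?thesis
  proof (rule subgroupI)
    show "A \<subseteq> carrier G" using c by blast
    show "A \<noteq> {}" using one by blast
  next
    fix x assume x: "x \<in> A"
    show "inv x \<in> A"
    proof (rule maximal[OF subgroup.m_inv_closed[OF K AK[OF x]]])
      fix a assume a: "a \<in> A"
      have "inv x \<otimes> a = inv x \<otimes> (a \<otimes> x) \<otimes> inv x"
        using c[OF x] c[OF a] by (simp add: m_assoc)
      also have "a \<otimes> x = x \<otimes> a" using abelian[OF a x] .
      also have "inv x \<otimes> (x \<otimes> a) \<otimes> inv x = a \<otimes> inv x"
        using c[OF x] c[OF a] by (simp add: cancel_left)
      finally show "inv x \<otimes> a = a \<otimes> inv x" .
    qed
  next
    fix x y assume x: "x \<in> A" and y: "y \<in> A"
    show "x \<otimes> y \<in> A"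
    proof (rule maximal[OF subgroup.m_closed[OF K AK[OF x] AK[OF y]]])
      fix a assume a: "a \<in> A"
      have "x \<otimes> y \<otimes> a = x \<otimes> (y \<otimes> a)" using c x y a by (simp add: m_assoc)
      also have "y \<otimes> a = a \<otimes> y" using abelian[OF y a] .
      also have "x \<otimes> (a \<otimes> y) = (x \<otimes> a) \<otimes> y" using c x y a by (simp add: m_assoc)
      also have "x \<otimes> a = a \<otimes> x" using abelian[OF x a] .
      also have "(a \<otimes> x) \<otimes> y = a \<otimes> (x \<otimes> y)" using c x y a by (simp add: m_assoc)
      finally show "x \<otimes> y \<otimes> a = a \<otimes> (x \<otimes> y)" .
    qed
  qed
qed

section \<open>Common eigenvectors and independence of weight vectors\<close>

definition matrix_poly_apply :: "complex^'n^'n \<Rightarrow> complex poly \<Rightarrow> complex^'n \<Rightarrow> complex^'n" where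
  "matrix_poly_apply M p v = (\<Sum>k\<le>degree p. coeff p k *s (((*v) M ^^ k) v))"

text \<open>The sum may run up to any bound on the degree, so that polynomials of different degrees can be compared term by term.\<close>

lemma matrix_poly_apply_bound:
  assumes "degree p \<le> N"
  shows "matrix_poly_apply M p v = (\<Sum>k\<le>N. coeff p k *s (((*v) M ^^ k) v))"
  unfolding matrix_poly_apply_def
proof (rule sum.mono_neutral_left)
  show "\<forall>k\<in>{..N} - {..degree p}. coeff p k *s (((*v) M ^^ k) v) = 0"
    by (simp add: coeff_eq_0)
qed (use assms in auto)

lemma matrix_mult_scale: "M *v (c *s w) = c *s (M *v w)" for M :: "complex^'n^'m"
  by (rule vector_scalar_commute)

lemma matrix_poly_apply_linear_factor:
  "matrix_poly_apply M ([:a, -1:] * q) v =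
    a *s matrix_poly_apply M q v - M *v matrix_poly_apply M q v"
proof -
  define N where "N = degree q"
  let ?f = "\<lambda>k. ((*v) M ^^ k) v"
  have "degree ([:a, -1:] * q) \<le> Suc N"
    using degree_mult_le[of "[:a, -1:]" q] by (auto simp: N_def)
  then have "matrix_poly_apply M ([:a, -1:] * q) v = (\<Sum>k\<le>Suc N. coeff ([:a, -1:] * q) k *s ?f k)"
    by (rule matrix_poly_apply_bound)
  also have "\<dots> = (\<Sum>k\<le>Suc N. (a * coeff q k) *s ?f k) - (\<Sum>k\<le>Suc N. coeff (pCons 0 q) k *s ?f k)"
  proof -
    have "coeff ([:a, -1:] * q) k = a * coeff q k - coeff (pCons 0 q) k" for k
      by (cases k) simp_all
    then show ?thesis
      by (simp only: sum_subtractf[symmetric] vec.scale_left_diff_distrib)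
  qed
  also have "(\<Sum>k\<le>Suc N. (a * coeff q k) *s ?f k) = a *s matrix_poly_apply M q v"
    using matrix_poly_apply_bound[of q "Suc N" M v]
    by (simp add: N_def vec.scale_sum_right del: sum.atMost_Suc)
  also have "(\<Sum>k\<le>Suc N. coeff (pCons 0 q) k *s ?f k) = (\<Sum>k\<le>N. coeff q k *s ?f (Suc k))"
    unfolding sum.atMost_Suc_shift by simp
  also have "\<dots> = M *v matrix_poly_apply M q v"
    by (simp add: matrix_poly_apply_def N_def vec.sum matrix_mult_scale)
  finally show ?thesis .
qed

text \<open>The iterates \<open>v, M v, \<dots>, M\<^sup>n v\<close> are too many to be independent in dimension \<open>n\<close>.\<close>

lemma annihilating_poly_exists:
  fixes M :: "complex^'n^'n"
  obtains p where "p \<noteq> 0" "matrix_poly_apply M p v = 0"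
proof -
  define f where "f = (\<lambda>k. ((*v) M ^^ k) v)"
  let ?n = "CARD('n)"
  show thesis
  proof (cases "inj_on f {..?n}")
    case True
    then have "card (f ` {..?n}) = Suc ?n" by (simp add: card_image)
    then have "vec.dependent (f ` {..?n})"
      using vec.independent_card_le_dim[of "f ` {..?n}" UNIV] vec_dim_card[where 'n='n and 'a=complex] by auto
    then obtain u where u: "\<exists>w\<in>f ` {..?n}. u w \<noteq> 0" "(\<Sum>w\<in>f ` {..?n}. u w *s w) = 0"
      by (subst (asm) vec.dependent_finite) auto
    define p where "p = (\<Sum>k\<le>?n. monom (u (f k)) k)"
    have co: "coeff p k = u (f k)" if "k \<le> ?n" for k
      using that unfolding p_def by (simp add: coeff_sum)
    have "degree p \<le> ?n" unfolding p_def
      by (rule degree_sum_le) (auto intro: order.trans[OF degree_monom_le])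
    then have "matrix_poly_apply M p v = (\<Sum>k\<le>?n. u (f k) *s f k)"
      by (simp add: matrix_poly_apply_bound co f_def)
    also have "\<dots> = 0" using u(2) by (simp add: sum.reindex[OF True])
    finally have "matrix_poly_apply M p v = 0" .
    moreover have "p \<noteq> 0" using u(1) co by fastforce
    ultimately show thesis using that by blast
  next
    case False
    \<comment> \<open>A repetition \<open>M\<^sup>i v = M\<^sup>j v\<close> gives the polynomial \<open>x\<^sup>i - x\<^sup>j\<close> directly; it cannot be read off
      from the set of iterates.\<close>
    then obtain i j where ij: "f i = f j" "i \<noteq> j" by (auto simp: inj_on_def)
    define p :: "complex poly" where "p = monom 1 i - monom 1 j"
    have "coeff p i = 1" using ij by (simp add: p_def)
    then have "p \<noteq> 0" by auto
    have "degree p \<le> i + j"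
      unfolding p_def by (rule degree_diff_le) (simp_all add: degree_monom_eq)
    then have "matrix_poly_apply M p v = (\<Sum>k\<le>i+j. coeff p k *s f k)"
      by (simp add: matrix_poly_apply_bound f_def)
    also have "\<dots> = (\<Sum>k\<le>i+j. if k = i then f k else 0) - (\<Sum>k\<le>i+j. if k = j then f k else 0)"
      unfolding sum_subtractf[symmetric] by (rule sum.cong) (use ij in \<open>auto simp: p_def\<close>)
    also have "\<dots> = 0" using ij by simp
    finally show thesis using that \<open>p \<noteq> 0\<close> by blast
  qed
qed

text \<open>Split off linear factors of a polynomial \<open>p\<close> with \<open>p(M) v = 0\<close> until a quotient \<open>q\<close> with
\<open>q(M) v \<noteq> 0\<close> remains; then \<open>q(M) v\<close> is an eigenvector, and it lies in \<open>W\<close> along with \<open>v\<close>. Working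
inside an invariant subspace is what makes the passage to commuting families possible.\<close>

lemma eigenvector_in_invariant_subspace:
  fixes M :: "complex^'n^'n"
  assumes W: "vec.subspace W" and inv: "\<And>w. w \<in> W \<Longrightarrow> M *v w \<in> W" and v: "v \<in> W" "v \<noteq> 0"
  obtains z w where "w \<in> W" "w \<noteq> 0" "M *v w = z *s w"
proof -
  have pow: "((*v) M ^^ k) v \<in> W" for k by (induction k) (use v inv in auto)
  have inW: "matrix_poly_apply M p v \<in> W" for p
    unfolding matrix_poly_apply_def
    by (intro vec.subspace_sum[OF W] vec.subspace_scale[OF W] pow)
  obtain p where p: "p \<noteq> 0" "matrix_poly_apply M p v = 0" by (rule annihilating_poly_exists)
  have "\<exists>z w. w \<in> W \<and> w \<noteq> 0 \<and> M *v w = z *s w"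
    using p
  proof (induction p rule: poly_root_induct[where P = "\<lambda>_. True"])
    case (no_roots p)
    then have "constant (poly p)" using fundamental_theorem_of_algebra by blast
    then obtain c where "p = [:c:]" by (metis constant_degree degree_eq_zeroE)
    then show ?case using no_roots v by (simp add: matrix_poly_apply_def vec.scale_eq_0_iff)
  next
    case (root a q)
    show ?case
    proof (cases "matrix_poly_apply M q v = 0")
      case True
      with root show ?thesis by (cases "q = 0") auto
    next
      case False
      moreover have "M *v matrix_poly_apply M q v = a *s matrix_poly_apply M q v"
        using root.prems(2) unfolding matrix_poly_apply_linear_factor by simp
      ultimately show ?thesis using inW by blast
    qed
  qed auto
  then show thesis using that by blast
qed

text \<open>On a nonzero invariant subspace of least dimension every matrix of the family acts as a scalar.\<close>

lemma commuting_matrices_common_eigenvector: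
  fixes A :: "(complex^'n^'n) set"
  assumes comm: "\<And>a b. a \<in> A \<Longrightarrow> b \<in> A \<Longrightarrow> a ** b = b ** a"
  obtains v where "v \<noteq> 0" "\<And>a. a \<in> A \<Longrightarrow> \<exists>z. a *v v = z *s v"
proof -
  define P where "P W \<longleftrightarrow> vec.subspace W \<and> W \<noteq> {0} \<and> (\<forall>a\<in>A. \<forall>w\<in>W. a *v w \<in> W)"
    for W :: "(complex^'n) set"
  have "axis undefined 1 \<noteq> (0 :: complex^'n)" by (simp add: axis_eq_0_iff)
  then have "(UNIV :: (complex^'n) set) \<noteq> {0}" by blast
  then have "P UNIV" unfolding P_def by simp
  then obtain W where W: "P W" and min: "\<And>U. P U \<Longrightarrow> vec.dim W \<le> vec.dim U"
    using ex_has_least_nat[of P UNIV vec.dim] by blast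
  have sub: "vec.subspace W" using W unfolding P_def by blast
  then obtain v where v: "v \<in> W" "v \<noteq> 0" using W vec.subspace_0 unfolding P_def by blast
  show thesis
  proof (rule that[OF v(2)])
    fix a assume a: "a \<in> A"
    obtain z w where w: "w \<in> W" "w \<noteq> 0" "a *v w = z *s w"
    proof (rule eigenvector_in_invariant_subspace[OF sub _ v, of a])
      show "a *v w \<in> W" if "w \<in> W" for w
        using W a that unfolding P_def by simp
    qed
    \<comment> \<open>The eigenspace of \<open>a\<close> in \<open>W\<close> is invariant because everything commutes with \<open>a\<close>, so minimality
      makes it all of \<open>W\<close>.\<close>
    define U where "U = {u \<in> W. a *v u = z *s u}"
    have "vec.subspace U"
      using sub unfolding U_def
      by (auto intro!: vec.subspaceI simp: vec.subspace_0 vec.subspace_add vec.subspace_scale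
          matrix_vector_right_distrib matrix_mult_scale vec.scale_right_distrib vec.scale_left_commute)
    moreover have "U \<noteq> {0}" using w unfolding U_def by blast
    moreover have "b *v u \<in> U" if "b \<in> A" "u \<in> U" for b u
    proof -
      have "a *v (b *v u) = b *v (a *v u)"
        using comm[OF a that(1)] by (simp add: matrix_vector_mul_assoc)
      then show ?thesis using that W unfolding U_def P_def by (simp add: matrix_mult_scale)
    qed
    ultimately have "P U" unfolding P_def by blast
    then have "U = W"
      using min[of U] vec.subspace_dim_equal[of U W] sub \<open>vec.subspace U\<close> unfolding U_def by blast
    then show "\<exists>z. a *v v = z *s v" using v(1) unfolding U_def by blast
  qed
qed

lemma independent_of_distinct_weights:
  fixes T :: "(complex^'n) set" and w :: "complex^'n \<Rightarrow> complex^'n^'n \<Rightarrow> complex"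
  assumes nz: "\<And>t. t \<in> T \<Longrightarrow> t \<noteq> 0"
    and eig: "\<And>t a. t \<in> T \<Longrightarrow> a \<in> A \<Longrightarrow> a *v t = w t a *s t"
    and distinct: "\<And>s t. s \<in> T \<Longrightarrow> t \<in> T \<Longrightarrow> s \<noteq> t \<Longrightarrow> \<exists>a\<in>A. w s a \<noteq> w t a"
  shows "vec.independent T"
  unfolding vec.independent_explicit_finite_subsets
proof (intro allI impI)
  fix S c assume "S \<subseteq> T" "finite S" "(\<Sum>t\<in>S. c t *s t) = 0"
  from this(2,1,3) show "\<forall>t\<in>S. c t = 0"
  proof (induction S arbitrary: c rule: finite_induct)
    case (insert t S)
    have "c s = 0" if s: "s \<in> S" for s
    proof -
      obtain a where a: "a \<in> A" "w s a \<noteq> w t a"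
        using distinct[of s t] insert.hyps insert.prems(1) s by auto
      \<comment> \<open>Applying \<open>a - w t a\<close> kills the summand of \<open>t\<close> and leaves a relation on \<open>S\<close>.\<close>
      have "0 = a *v (\<Sum>x\<in>insert t S. c x *s x) - w t a *s (\<Sum>x\<in>insert t S. c x *s x)"
        using insert.prems(2) by simp
      also have "\<dots> = (\<Sum>x\<in>insert t S. (c x * w x a) *s x) - (\<Sum>x\<in>insert t S. (w t a * c x) *s x)"
        using insert.prems(1) eig[OF _ a(1)]
        by (intro arg_cong2[of _ _ _ _ "(-)"])
          (auto simp: vec.sum matrix_mult_scale vec.scale_sum_right subset_iff simp del: sum.insert
            intro!: sum.cong)
      also have "\<dots> = (\<Sum>x\<in>insert t S. (c x * (w x a - w t a)) *s x)"
        unfolding sum_subtractf[symmetric] by (intro sum.cong) (simp_all add: algebra_simps vec.scale_left_diff_distrib)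
      also have "\<dots> = (\<Sum>x\<in>S. (c x * (w x a - w t a)) *s x)"
        using insert.hyps by simp
      finally have "\<forall>x\<in>S. c x * (w x a - w t a) = 0"
        using insert.IH[of "\<lambda>x. c x * (w x a - w t a)"] insert.prems(1) by simp
      then have "c s * (w s a - w t a) = 0" using s by blast
      then show ?thesis using a(2) by simp
    qed
    moreover from this have "c t *s t = 0" using insert.prems(2) insert.hyps by simp
    then have "c t = 0" using nz[of t] insert.prems(1) by (simp add: vec.scale_eq_0_iff)
    ultimately show ?case by simp
  qed simp
qed

section \<open>Signed permutation matrices and their patterns\<close>

lemma sign_nonzero: "x \<in> {1, -1} \<Longrightarrow> x \<noteq> (0 :: complex)"
  by auto

definition monomial_matrix :: "('n \<Rightarrow> 'n) \<Rightarrow> ('n \<Rightarrow> complex) \<Rightarrow> complex^'n^'n" where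
  "monomial_matrix \<sigma> \<epsilon> = (\<chi> i j. if i = \<sigma> j then \<epsilon> j else 0)"

lemma monomial_matrix_mult:
  "monomial_matrix \<sigma> \<epsilon> ** monomial_matrix \<tau> \<delta> = monomial_matrix (\<sigma> \<circ> \<tau>) (\<lambda>k. \<epsilon> (\<tau> k) * \<delta> k)"
proof -
  have "(\<Sum>j\<in>UNIV. (if i = \<sigma> j then \<epsilon> j else 0) * (if j = \<tau> k then \<delta> k else 0)) =
      (\<Sum>j\<in>UNIV. if j = \<tau> k then (if i = \<sigma> j then \<epsilon> j else 0) * \<delta> k else 0)" for i k
    by (rule sum.cong) auto
  then show ?thesis
    by (simp add: monomial_matrix_def matrix_matrix_mult_def vec_eq_iff)
qed

lemma monomial_matrix_id: "monomial_matrix id (\<lambda>_. 1) = mat 1"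
  unfolding monomial_matrix_def mat_def id_def by (rule refl)

lemma signed_permutation_iff_monomial:
  "signed_permutation A \<longleftrightarrow> (\<exists>\<sigma> \<epsilon>. bij \<sigma> \<and> (\<forall>j. \<epsilon> j \<in> {1, -1}) \<and> A = monomial_matrix \<sigma> \<epsilon>)"
  (is "?L \<longleftrightarrow> ?R")
proof
  assume A: ?L
  define \<sigma> where "\<sigma> j = (THE i. A $ i $ j \<noteq> 0)" for j
  have \<sigma>: "A $ i $ j \<noteq> 0 \<longleftrightarrow> i = \<sigma> j" for i j
  proof -
    have ex: "\<exists>!i. A $ i $ j \<noteq> 0" using A unfolding signed_permutation_def by simp
    show ?thesis using theI'[OF ex] ex unfolding \<sigma>_def by metis
  qed
  have "inj \<sigma>"
  proof (rule injI)
    fix j k assume "\<sigma> j = \<sigma> k"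
    then show "j = k" using A \<sigma> unfolding signed_permutation_def by metis
  qed
  then have "bij \<sigma>" by (simp add: bij_def finite_UNIV_inj_surj)
  moreover have "A = monomial_matrix \<sigma> (\<lambda>j. A $ \<sigma> j $ j)"
    unfolding monomial_matrix_def vec_eq_iff using \<sigma> by auto
  moreover have "A $ \<sigma> j $ j \<in> {1, -1}" for j
    using A \<sigma>[of "\<sigma> j" j] unfolding signed_permutation_def by simp
  ultimately show ?R
    by (intro exI[of _ \<sigma>] exI[of _ "\<lambda>j. A $ \<sigma> j $ j"]) simp
next
  assume ?R
  then obtain \<sigma> \<epsilon> where s: "bij \<sigma>" "\<And>j. \<epsilon> j \<in> {1, -1}" "A = monomial_matrix \<sigma> \<epsilon>" by blast
  have nz: "A $ i $ j \<noteq> 0 \<longleftrightarrow> i = \<sigma> j" for i j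
    using sign_nonzero[OF s(2)] unfolding s(3) monomial_matrix_def by simp
  have "\<exists>!j. i = \<sigma> j" for i
    using s(1) unfolding bij_iff by (simp add: eq_commute[of i])
  moreover have "A $ i $ j \<in> {1, -1}" if "A $ i $ j \<noteq> 0" for i j
    using that s(2)[of j] unfolding nz unfolding s(3) monomial_matrix_def by simp
  ultimately show ?L unfolding signed_permutation_def nz by simp
qed

lemma pattern_monomial_matrix:
  "(\<And>j. \<epsilon> j \<noteq> 0) \<Longrightarrow> pattern (monomial_matrix \<sigma> \<epsilon>) = monomial_matrix \<sigma> (\<lambda>_. 1)"
  by (simp add: pattern_def monomial_matrix_def vec_eq_iff)

lemma pattern_signed_permutation_mult:
  assumes "signed_permutation A" "signed_permutation B"
  shows "pattern (A ** B) = pattern A ** pattern B"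
proof -
  obtain \<sigma> \<epsilon> \<tau> \<delta> where *: "\<And>j. \<epsilon> j \<in> {1, -1}" "A = monomial_matrix \<sigma> \<epsilon>"
      "\<And>j. \<delta> j \<in> {1, -1}" "B = monomial_matrix \<tau> \<delta>"
    using assms unfolding signed_permutation_iff_monomial by blast
  have "\<epsilon> j \<noteq> 0" "\<delta> j \<noteq> 0" for j
    using sign_nonzero[OF *(1)] sign_nonzero[OF *(3)] by blast+
  then show ?thesis
    unfolding * by (simp add: monomial_matrix_mult pattern_monomial_matrix o_def)
qed

lemma invertible_pattern_signed_permutation:
  assumes "signed_permutation A"
  shows "invertible (pattern A)"
proof -
  obtain \<sigma> \<epsilon> where *: "bij \<sigma>" "\<And>j. \<epsilon> j \<in> {1, -1}" "A = monomial_matrix \<sigma> \<epsilon>"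
    using assms unfolding signed_permutation_iff_monomial by blast
  have "\<epsilon> j \<noteq> 0" for j using sign_nonzero[OF *(2)] .
  then have "pattern A ** monomial_matrix (inv_into UNIV \<sigma>) (\<lambda>_. 1) = mat 1"
    using *(1) unfolding *(3)
    by (simp add: pattern_monomial_matrix monomial_matrix_mult surj_iff[THEN iffD1] bij_is_surj
        monomial_matrix_id)
  then show ?thesis unfolding invertible_right_inverse by blast
qed

lemma trivial_pattern_monomial:
  assumes "signed_permutation A" "pattern A = mat 1"
  shows "\<exists>\<epsilon>. (\<forall>j. \<epsilon> j \<in> {1, -1}) \<and> A = monomial_matrix id \<epsilon>"
proof -
  obtain \<sigma> \<epsilon> where *: "\<And>j. \<epsilon> j \<in> {1, -1}" "A = monomial_matrix \<sigma> \<epsilon>"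
    using assms unfolding signed_permutation_iff_monomial by blast
  have "\<epsilon> j \<noteq> 0" for j using sign_nonzero[OF *(1)] .
  then have "monomial_matrix \<sigma> (\<lambda>_. 1) = mat 1" using assms(2) by (simp add: * pattern_monomial_matrix)
  then have "\<sigma> j = j" for j
    unfolding monomial_matrix_def mat_def vec_eq_iff by (auto dest: spec[of _ j] split: if_splits)
  then have "\<sigma> = id" by auto
  then show ?thesis using * by (intro exI[of _ \<epsilon>]) simp
qed

text \<open>Taking patterns is multiplicative on signed permutations and has invertible values, so a pair of patterns
commutes exactly when the commutator \<open>c\<close> of the two matrices has trivial pattern. Both
directions of the theorem pass through this equivalence.\<close>

lemma commutator_trivial_pattern_iff:
  fixes h k :: "complex^'n^'n"
  assumes "signed_permutation h" "signed_permutation k" "signed_permutation c"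
    and c: "h ** k = c ** (k ** h)" and kh: "signed_permutation (k ** h)"
  shows "pattern c = mat 1 \<longleftrightarrow> pattern h ** pattern k = pattern k ** pattern h"
proof -
  let ?p = "pattern k ** pattern h"
  have kh': "pattern (k ** h) = ?p"
    by (rule pattern_signed_permutation_mult[OF assms(2,1)])
  have eq: "pattern h ** pattern k = pattern c ** ?p"
    using pattern_signed_permutation_mult[OF assms(1,2)] pattern_signed_permutation_mult[OF assms(3) kh]
    unfolding kh' c by simp
  obtain q where q: "?p ** q = mat 1"
    using invertible_pattern_signed_permutation[OF kh] unfolding kh' invertible_right_inverse by blast
  show ?thesis
  proof
    assume "pattern h ** pattern k = ?p"
    then have "pattern c ** ?p ** q = ?p ** q" using eq by simp
    then have "pattern c ** (?p ** q) = ?p ** q" by (simp only: matrix_mul_assoc)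
    then show "pattern c = mat 1" by (simp only: q matrix_mul_rid)
  qed (simp add: eq)
qed

lemma matrix_vector_axis: "A *v axis j 1 = column j A" for A :: "complex^'n^'m"
proof -
  have "(\<Sum>k\<in>UNIV. A $ i $ k * (if k = j then 1 else 0)) = (\<Sum>k\<in>UNIV. if k = j then A $ i $ k else 0)" for i
    by (rule sum.cong) auto
  then show ?thesis
    by (simp add: matrix_vector_mult_def column_def axis_def vec_eq_iff)
qed

lemma monomial_matrix_axis:
  "monomial_matrix \<sigma> \<epsilon> *v axis j 1 = \<epsilon> j *s axis (\<sigma> j) (1 :: complex)"
  unfolding matrix_vector_axis
  by (simp add: monomial_matrix_def column_def axis_def vec_eq_iff)

lemma matrix_eq_on_axes:
  fixes A B :: "complex^'n^'m"
  assumes "\<And>j. A *v axis j 1 = B *v axis j 1"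
  shows "A = B"
  using assms unfolding matrix_vector_axis by (simp add: column_def vec_eq_iff)

section \<open>Scalar multiples of a matrix group\<close>

interpretation GL: group "GL :: (complex^'n^'n) monoid"
  by (rule group_GL)

lemma carrier_GL: "carrier GL = {A. invertible A}"
  and mult_GL: "A \<otimes>\<^bsub>GL\<^esub> B = A ** B"
  and one_GL: "\<one>\<^bsub>GL\<^esub> = mat 1"
  by (simp_all add: GL_def)

lemma GL_invD:
  assumes "invertible A"
  shows "A ** inv\<^bsub>GL\<^esub> A = mat 1" "inv\<^bsub>GL\<^esub> A ** A = mat 1" "invertible (inv\<^bsub>GL\<^esub> A)"
  using GL.r_inv[of A] GL.l_inv[of A] GL.inv_closed[of A] assms
  by (simp_all add: carrier_GL mult_GL one_GL)

lemma commutator_GL_eqI: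
  assumes "invertible x" "invertible y" "invertible c" "x ** y = c ** (y ** x)"
  shows "x ** y ** inv\<^bsub>GL\<^esub> x ** inv\<^bsub>GL\<^esub> y = c"
  using GL.commutator_eqI[of x y c] assms by (simp add: carrier_GL mult_GL)

text \<open>Products with \<open>mat c\<close> express scalar multiples inside the group \<open>GL\<close>, where the group-theoretic
lemmas apply.\<close>

lemma scalar_matrix_mult: "mat c ** A = (\<chi> i j. c * A $ i $ j)" for A :: "complex^'n^'n"
proof -
  have "(\<Sum>k\<in>UNIV. (if i = k then c else 0) * A $ k $ j) = (\<Sum>k\<in>UNIV. if i = k then c * A $ k $ j else 0)" for i j
    by (rule sum.cong) auto
  then show ?thesis by (simp add: matrix_matrix_mult_def mat_def vec_eq_iff)
qed

lemma scalar_matrix_commute: "mat c ** A = A ** mat c" for A :: "complex^'n^'n"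
proof -
  have "(\<Sum>k\<in>UNIV. A $ i $ k * (if k = j then c else 0)) = (\<Sum>k\<in>UNIV. if k = j then c * A $ i $ k else 0)" for i j
    by (rule sum.cong) auto
  then show ?thesis
    unfolding scalar_matrix_mult by (simp add: matrix_matrix_mult_def mat_def vec_eq_iff)
qed

lemma scalar_matrix_left_commute: "B ** (mat c ** A) = mat c ** (B ** A)"
  for A B :: "complex^'n^'n"
proof -
  have "B ** (mat c ** A) = (B ** mat c) ** A" by (simp only: matrix_mul_assoc)
  also have "\<dots> = (mat c ** B) ** A" by (simp only: scalar_matrix_commute)
  finally show ?thesis by (simp only: matrix_mul_assoc)
qed

lemma scalar_matrix_mult_scalar: "mat c ** mat d = (mat (c * d) :: complex^'n^'n)"
  unfolding scalar_matrix_mult by (simp add: mat_def vec_eq_iff)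

lemma scalar_matrix_vector: "mat c *v v = c *s v" for v :: "complex^'n"
proof -
  have "(\<Sum>k\<in>UNIV. (if i = k then c else 0) * v $ k) = (\<Sum>k\<in>UNIV. if i = k then c * v $ k else 0)" for i
    by (rule sum.cong) auto
  then show ?thesis by (simp add: matrix_vector_mult_def mat_def vec_eq_iff)
qed

lemma invertible_scalar_matrix: "c \<noteq> 0 \<Longrightarrow> invertible (mat c :: complex^'n^'n)"
  unfolding invertible_right_inverse
  by (rule exI[of _ "mat (inverse c)"]) (simp add: scalar_matrix_mult_scalar)

lemma scalar_products_mult:
  "(mat c ** A) ** (mat d ** B) = mat (c * d) ** (A ** B)" for A B :: "complex^'n^'n"
proof -
  have "(mat c ** A) ** (mat d ** B) = mat c ** (A ** mat d) ** B"
    by (simp add: matrix_mul_assoc)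
  also have "\<dots> = mat c ** mat d ** (A ** B)"
    unfolding scalar_matrix_commute[where c = d and A = A, symmetric] by (simp only: matrix_mul_assoc)
  finally show ?thesis by (simp add: scalar_matrix_mult_scalar)
qed

lemma scalar_subgroup: "subgroup {mat c |c. c \<noteq> 0} (GL :: (complex^'n^'n) monoid)"
proof (rule GL.subgroupI)
  show "{mat c |c. c \<noteq> 0} \<subseteq> carrier (GL :: (complex^'n^'n) monoid)"
    by (auto simp: carrier_GL invertible_scalar_matrix)
  show "{mat c |c. c \<noteq> 0} \<noteq> ({} :: (complex^'n^'n) set)"
    using zero_neq_one[where 'a = complex] by blast
  fix a :: "complex^'n^'n" assume "a \<in> {mat c |c. c \<noteq> 0}"
  then obtain c where c: "a = mat c" "c \<noteq> 0" by blast
  have "inv\<^bsub>GL\<^esub> a = mat (inverse c)"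
    using c by (intro GL.inv_equality)
      (simp_all add: carrier_GL mult_GL one_GL invertible_scalar_matrix scalar_matrix_mult_scalar)
  then show "inv\<^bsub>GL\<^esub> a \<in> {mat c |c. c \<noteq> 0}"
    using c(2) by (intro CollectI exI[of _ "inverse c"]) simp
  fix b :: "complex^'n^'n" assume "b \<in> {mat c |c. c \<noteq> 0}"
  then obtain d where d: "b = mat d" "d \<noteq> 0" by blast
  show "a \<otimes>\<^bsub>GL\<^esub> b \<in> {mat c |c. c \<noteq> 0}"
    using c d by (intro CollectI exI[of _ "c * d"]) (simp add: mult_GL scalar_matrix_mult_scalar)
qed

text \<open>The scalar matrices form a divisible group, because complex numbers have roots.\<close>

lemma scalar_matrix_root:
  assumes "c \<noteq> 0" "(k::nat) > 0"
  shows "\<exists>d. d \<noteq> 0 \<and> mat d [^]\<^bsub>GL\<^esub> k = (mat c :: complex^'n^'n)"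
proof -
  define d where "d = exp (Ln c / of_nat k)"
  have "d ^ k = exp (of_nat k * (Ln c / of_nat k))"
    unfolding d_def by (rule exp_of_nat_mult[symmetric])
  then have "d ^ k = c" using assms by simp
  moreover have "mat d [^]\<^bsub>GL\<^esub> j = (mat (d ^ j) :: complex^'n^'n)" for j :: nat
    by (induction j) (simp_all add: one_GL mult_GL scalar_matrix_mult_scalar mult.commute)
  moreover have "d \<noteq> 0" by (simp add: d_def)
  ultimately show ?thesis by auto
qed

lemma nonzero_multiples_eq: "nonzero_multiples S = {mat c ** A |c A. c \<noteq> 0 \<and> A \<in> S}"
  unfolding nonzero_multiples_def scalar_matrix_mult ..

lemma subset_nonzero_multiples: "S \<subseteq> nonzero_multiples S" for S :: "(complex^'n^'n) set"
proof
  fix A assume "A \<in> S"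
  then have "mat 1 ** A \<in> nonzero_multiples S"
    unfolding nonzero_multiples_eq by (intro CollectI exI[of _ 1] exI[of _ A]) simp
  then show "A \<in> nonzero_multiples S" by simp
qed

lemma subgroup_nonzero_multiples:
  assumes "subgroup S (GL :: (complex^'n^'n) monoid)"
  shows "subgroup (nonzero_multiples S) GL"
proof (rule GL.subgroupI)
  have inv: "invertible A" if "A \<in> S" for A
    using subgroup.mem_carrier[OF assms that] by (simp add: carrier_GL)
  show "nonzero_multiples S \<subseteq> carrier GL"
    unfolding nonzero_multiples_eq carrier_GL
    using inv by (auto intro!: invertible_mult invertible_scalar_matrix)
  have "mat 1 ** \<one>\<^bsub>GL\<^esub> \<in> nonzero_multiples S"
    unfolding nonzero_multiples_eq using subgroup.one_closed[OF assms]
    by (intro CollectI exI[of _ 1] exI[of _ "\<one>\<^bsub>GL\<^esub>"]) simp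
  then show "nonzero_multiples S \<noteq> {}" by blast
  fix x assume "x \<in> nonzero_multiples S"
  then obtain c A where x: "x = mat c ** A" "c \<noteq> 0" "A \<in> S" unfolding nonzero_multiples_eq by blast
  have "(mat (inverse c) ** inv\<^bsub>GL\<^esub> A) ** x = mat 1"
    unfolding x(1) scalar_products_mult using x inv by (simp add: GL_invD)
  then have "inv\<^bsub>GL\<^esub> x = mat (inverse c) ** inv\<^bsub>GL\<^esub> A"
    by (intro GL.inv_equality)
      (use x inv in \<open>auto simp: mult_GL one_GL carrier_GL intro!: invertible_mult invertible_scalar_matrix GL_invD\<close>)
  then show "inv\<^bsub>GL\<^esub> x \<in> nonzero_multiples S"
    unfolding nonzero_multiples_eq using x(2) subgroup.m_inv_closed[OF assms x(3)]
    by (intro CollectI exI[of _ "inverse c"] exI[of _ "inv\<^bsub>GL\<^esub> A"]) simp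
  fix y assume "y \<in> nonzero_multiples S"
  then obtain d B where y: "y = mat d ** B" "d \<noteq> 0" "B \<in> S" unfolding nonzero_multiples_eq by blast
  show "x \<otimes>\<^bsub>GL\<^esub> y \<in> nonzero_multiples S"
    unfolding nonzero_multiples_eq mult_GL x(1) y(1) scalar_products_mult
    using x(2) y(2) subgroup.m_closed[OF assms x(3) y(3)]
    by (intro CollectI exI[of _ "c * d"] exI[of _ "A ** B"]) (simp add: mult_GL)
qed

text \<open>Scalars are central, so they cancel in commutators.\<close>

lemma commutator_scalar_multiples:
  fixes x y :: "complex^'n^'n"
  assumes "invertible x" "invertible y" "c \<noteq> 0" "d \<noteq> 0"
  defines "x' \<equiv> mat c ** x" and "y' \<equiv> mat d ** y"
  shows "x' ** y' ** inv\<^bsub>GL\<^esub> x' ** inv\<^bsub>GL\<^esub> y' = x ** y ** inv\<^bsub>GL\<^esub> x ** inv\<^bsub>GL\<^esub> y"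
proof (rule commutator_GL_eqI)
  let ?k = "x ** y ** inv\<^bsub>GL\<^esub> x ** inv\<^bsub>GL\<^esub> y"
  show "invertible x'" "invertible y'" "invertible ?k"
    unfolding x'_def y'_def using assms
    by (auto intro!: invertible_mult invertible_scalar_matrix GL_invD)
  have "?k ** (y ** x) = x ** y"
    using GL.commutator_swap[of x y] assms(1,2) by (simp add: carrier_GL mult_GL)
  moreover have "?k ** (mat (d * c) ** (y ** x)) = mat (d * c) ** (?k ** (y ** x))"
    by (rule scalar_matrix_left_commute)
  ultimately show "x' ** y' = ?k ** (y' ** x')"
    unfolding x'_def y'_def scalar_products_mult by (simp add: mult.commute)
qed

lemma commutator_nonzero_multiples_in_derived:
  assumes S: "subgroup S (GL :: (complex^'n^'n) monoid)"
    and "x \<in> nonzero_multiples S" "y \<in> nonzero_multiples S"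
  shows "x ** y ** inv\<^bsub>GL\<^esub> x ** inv\<^bsub>GL\<^esub> y \<in> derived GL S"
proof -
  obtain c A d B where *: "x = mat c ** A" "c \<noteq> 0" "A \<in> S" "y = mat d ** B" "d \<noteq> 0" "B \<in> S"
    using assms(2,3) unfolding nonzero_multiples_eq by blast
  have "invertible A" "invertible B"
    using subgroup.mem_carrier[OF S] *(3,6) by (simp_all add: carrier_GL)
  then have "x ** y ** inv\<^bsub>GL\<^esub> x ** inv\<^bsub>GL\<^esub> y = A ** B ** inv\<^bsub>GL\<^esub> A ** inv\<^bsub>GL\<^esub> B"
    unfolding *(1,4) using *(2,5) by (intro commutator_scalar_multiples)
  also have "\<dots> \<in> derived_set GL S"
    using *(3,6) by (auto simp: mult_GL)
  finally show ?thesis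
    unfolding derived_def by (rule generate.incl)
qed

section \<open>From signed permutations to involutions\<close>

text \<open>Scalars do not affect commutators, so commutators of \<open>G\<close> are conjugate by \<open>X\<close> to commutators of \<open>H\<close>.
Commutativity of patterns makes the latter diagonal with diagonal entries \<open>1\<close> or \<open>-1\<close>. These diagonal
matrices form a group of involutions, so the generated subgroup consists of involutions as well.\<close>

lemma derived_involutions_of_signed_form:
  fixes G H :: "(complex^'n^'n) set"
  assumes G: "subgroup G GL" and X: "invertible X"
    and H: "signed_permutation_group H" "commutative_pattern H"
    and sub: "(\<lambda>A. matrix_inv X ** A ** X) ` G \<subseteq> nonzero_multiples H"
    and J: "J \<in> derived GL G"
  shows "matrix_involution J"
proof -
  \<comment> \<open>The diagonal sign matrices form a group of involutions; its conjugate by \<open>X\<close> will contain every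
    commutator of \<open>G\<close>.\<close>
  define \<Delta> :: "(complex^'n^'n) set" where
    "\<Delta> = {monomial_matrix id \<epsilon> |\<epsilon>. \<forall>j. \<epsilon> j \<in> {1, -1}}"
  have \<Delta>_mult: "monomial_matrix id \<epsilon> ** monomial_matrix id \<delta> = (monomial_matrix id (\<lambda>j. \<epsilon> j * \<delta> j) :: complex^'n^'n)" for \<epsilon> \<delta>
    by (simp add: monomial_matrix_mult)
  have \<Delta>_inv: "D ** D = mat 1" if D: "D \<in> \<Delta>" for D
  proof -
    obtain \<epsilon> where \<epsilon>: "D = monomial_matrix id \<epsilon>" "\<And>j. \<epsilon> j \<in> {1, -1}" using D unfolding \<Delta>_def by blast
    have "\<epsilon> j * \<epsilon> j = 1" for j using \<epsilon>(2)[of j] by auto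
    then show ?thesis by (simp add: \<epsilon>(1) \<Delta>_mult monomial_matrix_id)
  qed
  have \<Delta>_carrier: "invertible D" if "D \<in> \<Delta>" for D
    using \<Delta>_inv[OF that] unfolding invertible_right_inverse by blast
  have \<Delta>: "subgroup \<Delta> GL"
  proof (rule GL.subgroupI)
    show "\<Delta> \<subseteq> carrier GL" using \<Delta>_carrier by (auto simp: carrier_GL)
    have "monomial_matrix id (\<lambda>_. 1) \<in> \<Delta>" unfolding \<Delta>_def by blast
    then show "\<Delta> \<noteq> {}" by blast
    fix D assume D: "D \<in> \<Delta>"
    have "inv\<^bsub>GL\<^esub> D = D"
      using \<Delta>_inv[OF D] \<Delta>_carrier[OF D] by (intro GL.inv_equality) (simp_all add: carrier_GL mult_GL one_GL)
    then show "inv\<^bsub>GL\<^esub> D \<in> \<Delta>" using D by simp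
    fix D' assume D': "D' \<in> \<Delta>"
    obtain \<epsilon> \<delta> where *: "D = monomial_matrix id \<epsilon>" "\<And>j. \<epsilon> j \<in> {1, -1}"
      "D' = monomial_matrix id \<delta>" "\<And>j. \<delta> j \<in> {1, -1}" using D D' unfolding \<Delta>_def by blast
    have "\<epsilon> j * \<delta> j \<in> {1, -1}" for j using *(2)[of j] *(4)[of j] by auto
    then show "D \<otimes>\<^bsub>GL\<^esub> D' \<in> \<Delta>"
      unfolding mult_GL *(1,3) \<Delta>_mult \<Delta>_def by blast
  qed
  define \<Gamma> where "\<Gamma> = (\<lambda>D. X \<otimes>\<^bsub>GL\<^esub> D \<otimes>\<^bsub>GL\<^esub> inv\<^bsub>GL\<^esub> X) ` \<Delta>"
  have Xc: "X \<in> carrier GL" using X by (simp add: carrier_GL)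
  have \<Gamma>: "subgroup \<Gamma> GL" unfolding \<Gamma>_def by (rule GL.conjugate_subgroup[OF Xc \<Delta>])
  have Hs: "subgroup H GL" and signed: "\<And>h. h \<in> H \<Longrightarrow> signed_permutation h"
    using H(1) unfolding signed_permutation_group_def by auto
  have Hc: "h \<in> carrier GL" if "h \<in> H" for h using subgroup.mem_carrier[OF Hs that] .
  have form: "\<exists>a h. a \<noteq> 0 \<and> h \<in> H \<and> A = mat a ** (X ** h ** inv\<^bsub>GL\<^esub> X)" if A: "A \<in> G" for A
  proof -
    obtain a h where ah: "matrix_inv X ** A ** X = mat a ** h" "a \<noteq> 0" "h \<in> H"
      using sub A unfolding nonzero_multiples_eq by blast
    have "A = X ** (matrix_inv X ** A ** X) ** inv\<^bsub>GL\<^esub> X"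
    proof -
      have "X ** (inv\<^bsub>GL\<^esub> X ** A ** X) ** inv\<^bsub>GL\<^esub> X = (X ** inv\<^bsub>GL\<^esub> X) ** A ** (X ** inv\<^bsub>GL\<^esub> X)"
        by (simp only: matrix_mul_assoc)
      then show ?thesis using GL_invD(1)[OF X] inv_GL[OF X] by simp
    qed
    also have "\<dots> = mat a ** (X ** h ** inv\<^bsub>GL\<^esub> X)"
      unfolding ah(1) scalar_matrix_left_commute by (simp only: matrix_mul_assoc)
    finally show ?thesis using ah by blast
  qed
  have "derived_set GL G \<subseteq> \<Gamma>"
  proof
    fix c assume "c \<in> derived_set GL G"
    then obtain A B where AB: "A \<in> G" "B \<in> G" "c = A ** B ** inv\<^bsub>GL\<^esub> A ** inv\<^bsub>GL\<^esub> B"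
      by (auto simp: mult_GL)
    obtain a h where ah: "a \<noteq> 0" "h \<in> H" "A = mat a ** (X ** h ** inv\<^bsub>GL\<^esub> X)" using form[OF AB(1)] by blast
    obtain b k where bk: "b \<noteq> 0" "k \<in> H" "B = mat b ** (X ** k ** inv\<^bsub>GL\<^esub> X)" using form[OF AB(2)] by blast
    define d where "d = h \<otimes>\<^bsub>GL\<^esub> k \<otimes>\<^bsub>GL\<^esub> inv\<^bsub>GL\<^esub> h \<otimes>\<^bsub>GL\<^esub> inv\<^bsub>GL\<^esub> k"
    have dH: "d \<in> H" unfolding d_def
      by (intro subgroup.m_closed[OF Hs] subgroup.m_inv_closed[OF Hs] ah(2) bk(2))
    have "invertible (X ** h ** inv\<^bsub>GL\<^esub> X)" "invertible (X ** k ** inv\<^bsub>GL\<^esub> X)"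
      using X Hc[OF ah(2)] Hc[OF bk(2)] by (auto simp: carrier_GL intro!: invertible_mult GL_invD)
    from commutator_scalar_multiples[OF this ah(1) bk(1)]
    have "c = X \<otimes>\<^bsub>GL\<^esub> d \<otimes>\<^bsub>GL\<^esub> inv\<^bsub>GL\<^esub> X"
      unfolding AB(3) ah(3) bk(3) d_def
      using GL.conjugate_of_commutator[OF Xc Hc[OF ah(2)] Hc[OF bk(2)]] by (simp add: mult_GL)
    moreover have "d \<in> \<Delta>"
    proof -
      have "h ** k = d ** (k ** h)"
        unfolding d_def using GL.commutator_swap[OF Hc[OF ah(2)] Hc[OF bk(2)]] by (simp add: mult_GL)
      moreover have "signed_permutation (k ** h)"
        using signed[OF subgroup.m_closed[OF Hs bk(2) ah(2)]] by (simp add: mult_GL)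
      moreover have "pattern h ** pattern k = pattern k ** pattern h"
        using H(2) ah(2) bk(2) unfolding commutative_pattern_def by simp
      ultimately have "pattern d = mat 1"
        using commutator_trivial_pattern_iff[OF signed[OF ah(2)] signed[OF bk(2)] signed[OF dH]] by simp
      from trivial_pattern_monomial[OF signed[OF dH] this] show ?thesis unfolding \<Delta>_def by blast
    qed
    ultimately show "c \<in> \<Gamma>" unfolding \<Gamma>_def by blast
  qed
  then have "derived GL G \<subseteq> \<Gamma>"
    unfolding derived_def by (rule GL.generate_subgroup_incl[OF _ \<Gamma>])
  then obtain D where D: "D \<in> \<Delta>" "J = X ** D ** inv\<^bsub>GL\<^esub> X"
    using J unfolding \<Gamma>_def mult_GL by blast
  have "J ** J = X ** D ** (inv\<^bsub>GL\<^esub> X ** X) ** D ** inv\<^bsub>GL\<^esub> X"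
    unfolding D(2) by (simp only: matrix_mul_assoc)
  also have "\<dots> = X ** (D ** D) ** inv\<^bsub>GL\<^esub> X"
    by (simp add: GL_invD(2)[OF X] matrix_mul_assoc)
  finally show ?thesis
    unfolding matrix_involution_def by (simp add: \<Delta>_inv[OF D(1)] GL_invD(1)[OF X])
qed

section \<open>From involutions to signed permutations\<close>

lemma irreducible_matrices_mono:
  "irreducible_matrices S \<Longrightarrow> S \<subseteq> R \<Longrightarrow> irreducible_matrices R"
  unfolding irreducible_matrices_def by blast

lemma irreducible_invariant_span:
  fixes S :: "(complex^'n^'n) set"
  assumes irr: "irreducible_matrices S" and v: "v \<in> E" "v \<noteq> 0"
    and inv: "\<And>g e. g \<in> S \<Longrightarrow> e \<in> E \<Longrightarrow> g *v e \<in> vec.span E"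
  shows "vec.span E = UNIV"
proof -
  have "g *v w \<in> vec.span E" if g: "g \<in> S" and w: "w \<in> vec.span E" for g w
  proof (rule vec.span_induct[OF w])
    show "vec.subspace {x. g *v x \<in> vec.span E}"
      by (rule vec.subspaceI)
        (auto simp: matrix_vector_right_distrib matrix_mult_scale vec.span_zero vec.span_add vec.span_scale)
  qed (use inv g in blast)
  then have "vec.span E = {0} \<or> vec.span E = UNIV"
    using irr vec.subspace_span unfolding irreducible_matrices_def by blast
  then show ?thesis using v vec.span_base by blast
qed

lemma self_centralizing_with_common_eigenvector:
  fixes K D :: "(complex^'n^'n) set"
  assumes K: "subgroup K GL" and D: "D \<subseteq> K" "\<And>x y. x \<in> D \<Longrightarrow> y \<in> D \<Longrightarrow> x ** y = y ** x"
  obtains A v lam where "subgroup A GL" "D \<subseteq> A" "A \<subseteq> K"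
    "\<And>x y. x \<in> A \<Longrightarrow> y \<in> A \<Longrightarrow> x ** y = y ** x"
    "\<And>g. g \<in> K \<Longrightarrow> (\<And>a. a \<in> A \<Longrightarrow> g ** a = a ** g) \<Longrightarrow> g \<in> A"
    "v \<noteq> 0" "\<And>a. a \<in> A \<Longrightarrow> a *v v = lam a *s v"
proof (rule maximal_commuting_superset[of D K "(**)", OF D])
  fix A
  assume A: "D \<subseteq> A" "A \<subseteq> K" "\<And>x y. x \<in> A \<Longrightarrow> y \<in> A \<Longrightarrow> x ** y = y ** x"
    "\<And>g. g \<in> K \<Longrightarrow> (\<And>a. a \<in> A \<Longrightarrow> g ** a = a ** g) \<Longrightarrow> g \<in> A"
  have sub: "subgroup A GL"
    using GL.self_centralizing_subgroup[OF K A(2), unfolded mult_GL, OF A(3,4)] .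
  obtain v where v: "v \<noteq> 0" "\<And>a. a \<in> A \<Longrightarrow> \<exists>z. a *v v = z *s v"
    using commuting_matrices_common_eigenvector[OF A(3)] by blast
  then obtain lam where "\<And>a. a \<in> A \<Longrightarrow> a *v v = lam a *s v" by metis
  then show thesis using that[OF sub A v(1)] by blast
qed

text \<open>The heart of the argument. A self-centralizing abelian subgroup \<open>A\<close> containing all commutators is
the full stabilizer of each of its weights. For \<open>g\<close> in the stabilizer of the weight of \<open>v\<close>, every
commutator \<open>[g, a]\<close> fixes \<open>v\<close>; as the conjugates of these commutators have the same form, they
fix the whole orbit of \<open>v\<close>, which spans by irreducibility. Thus \<open>[g, a] = 1\<close> for all \<open>a\<close>, and \<open>g\<close>
centralizes \<open>A\<close>.\<close>

lemma weight_stabilizer_in_self_centralizing: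
  fixes K A :: "(complex^'n^'n) set"
  assumes K: "subgroup K GL" "irreducible_matrices K"
    and A: "subgroup A GL" "A \<subseteq> K"
    and abelian: "\<And>x y. x \<in> A \<Longrightarrow> y \<in> A \<Longrightarrow> x ** y = y ** x"
    and maximal: "\<And>g. g \<in> K \<Longrightarrow> (\<And>a. a \<in> A \<Longrightarrow> g ** a = a ** g) \<Longrightarrow> g \<in> A"
    and comm: "\<And>x y. x \<in> K \<Longrightarrow> y \<in> K \<Longrightarrow> x ** y ** inv\<^bsub>GL\<^esub> x ** inv\<^bsub>GL\<^esub> y \<in> A"
    and v: "v \<noteq> 0" "\<And>a. a \<in> A \<Longrightarrow> a *v v = lam a *s v"
    and g: "g \<in> K" and stab: "\<And>a. a \<in> A \<Longrightarrow> lam (inv\<^bsub>GL\<^esub> g ** a ** g) = lam a"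
  shows "g \<in> A"
proof (rule maximal[OF g])
  have inv: "invertible x" if "x \<in> K" for x
    using subgroup.mem_carrier[OF K(1) that] by (simp add: carrier_GL)
  have AK: "a \<in> K" if "a \<in> A" for a using that A(2) by blast
  \<comment> \<open>The common fixed space of the commutators \<open>[g, a]\<close> is invariant under \<open>K\<close>, since conjugation
    permutes these commutators, and it contains \<open>v\<close>, since \<open>g\<close> fixes the weight.\<close>
  define W where "W = {w. \<forall>a\<in>A. (g ** a ** inv\<^bsub>GL\<^esub> g ** inv\<^bsub>GL\<^esub> a) *v w = w}"
  have "vec.subspace W"
    unfolding W_def
    by (rule vec.subspaceI) (simp_all add: matrix_vector_right_distrib matrix_mult_scale)
  moreover have "h *v w \<in> W" if h: "h \<in> K" and w: "w \<in> W" for h w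
    unfolding W_def
  proof (intro CollectI ballI)
    fix a assume a: "a \<in> A"
    let ?k = "g ** a ** inv\<^bsub>GL\<^esub> g ** inv\<^bsub>GL\<^esub> a"
    obtain a' where a': "a' \<in> A"
      "inv\<^bsub>GL\<^esub> h ** ?k ** h = g ** a' ** inv\<^bsub>GL\<^esub> g ** inv\<^bsub>GL\<^esub> a'"
      using GL.conjugate_commutator[OF K(1) A, unfolded mult_GL, OF abelian comm g h a] by blast
    have "?k ** h = h ** (inv\<^bsub>GL\<^esub> h ** ?k ** h)"
      by (simp add: matrix_mul_assoc GL_invD inv[OF h])
    then have "?k *v (h *v w) = h *v ((inv\<^bsub>GL\<^esub> h ** ?k ** h) *v w)"
      by (simp only: matrix_vector_mul_assoc)
    also have "\<dots> = h *v w"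
      using w a'(1) unfolding W_def a'(2) by simp
    finally show "?k *v (h *v w) = h *v w" .
  qed
  moreover have "v \<in> W"
    unfolding W_def
  proof (intro CollectI ballI)
    fix a assume a: "a \<in> A"
    let ?c = "g ** a ** inv\<^bsub>GL\<^esub> g"
    have "inv\<^bsub>GL\<^esub> (inv\<^bsub>GL\<^esub> g) ** a ** inv\<^bsub>GL\<^esub> g \<in> A"
      using GL.conjugate_in_commutator_closed[OF K(1) A, unfolded mult_GL,
          OF comm subgroup.m_inv_closed[OF K(1) g] a] .
    then have c: "?c \<in> A"
      using GL.inv_inv[of g] inv[OF g] by (simp add: carrier_GL)
    have "inv\<^bsub>GL\<^esub> g ** ?c ** g = (inv\<^bsub>GL\<^esub> g ** g) ** a ** (inv\<^bsub>GL\<^esub> g ** g)"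
      by (simp only: matrix_mul_assoc)
    then have "lam ?c = lam a"
      using stab[OF c] GL_invD(2)[OF inv[OF g]] by simp
    then have cv: "?c *v v = a *v v" using v(2)[OF c] v(2)[OF a] by simp
    have ia: "inv\<^bsub>GL\<^esub> a \<in> A" using subgroup.m_inv_closed[OF A(1) a] .
    have "(?c ** inv\<^bsub>GL\<^esub> a) *v v = inv\<^bsub>GL\<^esub> a *v (?c *v v)"
      unfolding abelian[OF c ia] by (simp only: matrix_vector_mul_assoc)
    also have "\<dots> = v"
      unfolding cv by (simp add: matrix_vector_mul_assoc GL_invD inv[OF AK[OF a]])
    finally show "(?c ** inv\<^bsub>GL\<^esub> a) *v v = v" .
  qed
  ultimately have W: "W = UNIV"
    using K(2) v(1) unfolding irreducible_matrices_def by blast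
  fix a assume a: "a \<in> A"
  have "g ** a ** inv\<^bsub>GL\<^esub> g ** inv\<^bsub>GL\<^esub> a = mat 1"
    unfolding matrix_eq using W a unfolding W_def by (simp add: set_eq_iff)
  then show "g ** a = a ** g"
    using GL.commutator_swap[of g a] inv[OF g] inv[OF AK[OF a]] by (simp add: carrier_GL mult_GL)
qed

lemma signs_modulo_negation:
  fixes E :: "(complex^'n) set"
  assumes nz: "0 \<notin> E"
  obtains T where "T \<subseteq> E" "\<And>t. t \<in> T \<Longrightarrow> - t \<notin> T" "\<And>e. e \<in> E \<Longrightarrow> - e \<in> E \<Longrightarrow> e \<in> T \<or> - e \<in> T"
proof -
  define f where "f e = (SOME x. x \<in> {e, - e})" for e :: "complex^'n"
  have f: "f e \<in> {e, - e}" for e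
    unfolding f_def by (rule someI[of _ e]) simp
  have fm: "f (- e) = f e" for e
    unfolding f_def by (simp add: insert_commute)
  \<comment> \<open>The choice depends only on the set \<open>{e, - e}\<close>, hence agrees for \<open>e\<close> and \<open>- e\<close>.\<close>
  define T where "T = f ` E \<inter> E"
  show thesis
  proof (rule that[of T])
    show "T \<subseteq> E" unfolding T_def by blast
    fix t assume t: "t \<in> T"
    have ft: "f s = s" if "s \<in> T" for s
      using that f fm unfolding T_def by (metis IntE imageE insertE minus_minus singletonD)
    show "- t \<notin> T"
    proof
      assume "- t \<in> T"
      then have "- t = t" using ft[OF t] ft[of "- t"] fm[of t] by simp
      then have "t = 0" by (simp add: vec_eq_iff)
      then show False using t nz unfolding T_def by blast
    qed
  next
    fix e assume "e \<in> E" "- e \<in> E"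
    then have "f e \<in> E" using f[of e] by auto
    then have "f e \<in> T" using \<open>e \<in> E\<close> unfolding T_def by simp
    then show "e \<in> T \<or> - e \<in> T" using f[of e] by auto
  qed
qed

text \<open>The columns of \<open>X\<close> are the elements of \<open>T\<close>. Each \<open>h\<close> then moves the columns up to sign by a map of
indices; that map is injective because \<open>h\<close> is invertible and \<open>T\<close> contains no opposite vectors, so it
is a permutation.\<close>

lemma signed_permutations_in_basis:
  fixes H :: "(complex^'n^'n) set" and T :: "(complex^'n) set"
  assumes inv: "\<And>h. h \<in> H \<Longrightarrow> invertible h"
    and indep: "vec.independent T" and span: "vec.span T = UNIV"
    and perm: "\<And>h t. h \<in> H \<Longrightarrow> t \<in> T \<Longrightarrow> h *v t \<in> T \<or> - (h *v t) \<in> T"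
    and no_neg: "\<And>t. t \<in> T \<Longrightarrow> - t \<notin> T"
  shows "\<exists>X :: complex^'n^'n. invertible X \<and>
    (\<forall>h\<in>H. signed_permutation (matrix_inv X ** h ** X)) \<and>
    (\<forall>h\<in>H. (\<forall>t\<in>T. h *v t \<in> {t, - t}) \<longrightarrow> pattern (matrix_inv X ** h ** X) = mat 1)"
proof -
  have "card T = CARD('n)"
    using vec.dim_eq_card[of T UNIV] span indep vec_dim_card[where 'a = complex and 'n = 'n] by simp
  moreover have "finite T" using indep vec.finiteI_independent by blast
  ultimately obtain \<beta> :: "'n \<Rightarrow> complex^'n" where \<beta>: "bij_betw \<beta> UNIV T"
    using finite_same_card_bij[of "UNIV :: 'n set" T] by auto
  define X :: "complex^'n^'n" where "X = (\<chi> i j. \<beta> j $ i)"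
  have col: "column j X = \<beta> j" for j by (simp add: X_def column_def vec_eq_iff)
  have Xax: "X *v axis j 1 = \<beta> j" for j
    by (simp add: matrix_vector_axis col)
  have "columns X = T" using \<beta> unfolding columns_def col bij_betw_def by auto
  then have X: "invertible X"
    unfolding invertible_right_inverse matrix_right_invertible_span_columns using span by simp
  have X': "matrix_inv X ** X = mat 1"
    using GL_invD(2)[OF X] inv_GL[OF X] by simp
  have Xb: "matrix_inv X *v \<beta> j = axis j 1" for j
    unfolding Xax[symmetric] by (simp add: matrix_vector_mul_assoc X')
  have \<beta>T: "\<beta> j \<in> T" for j using \<beta> unfolding bij_betw_def by blast
  \<comment> \<open>Basis vectors that agree up to sign are equal, because \<open>T\<close> contains no vector with its negative.\<close>
  have \<beta>_inj: "i = j" if "\<beta> i = s *s \<beta> j" "s \<in> {1, -1}" for i j s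
  proof -
    have "\<beta> i = \<beta> j" using that no_neg[OF \<beta>T[of j]] \<beta>T[of i] by auto
    then show ?thesis using \<beta> unfolding bij_betw_def by (meson UNIV_I inj_onD)
  qed
  have main: "\<exists>\<sigma> \<epsilon>. bij \<sigma> \<and> (\<forall>j. \<epsilon> j \<in> {1, -1}) \<and> matrix_inv X ** h ** X = monomial_matrix \<sigma> \<epsilon>
      \<and> (\<forall>j. h *v \<beta> j = \<epsilon> j *s \<beta> (\<sigma> j))" if h: "h \<in> H" for h
  proof -
    have "\<exists>i s. s \<in> {1, -1} \<and> h *v \<beta> j = s *s \<beta> i" for j
    proof (cases "h *v \<beta> j \<in> T")
      case True
      then obtain i where "h *v \<beta> j = \<beta> i" using \<beta> unfolding bij_betw_def by blast
      then show ?thesis by (intro exI[of _ i] exI[of _ 1]) simp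
    next
      case False
      then have "- (h *v \<beta> j) \<in> T" using perm[OF h \<beta>T] by blast
      then obtain i where "- (h *v \<beta> j) = \<beta> i" using \<beta> unfolding bij_betw_def by blast
      then have "h *v \<beta> j = - \<beta> i" by (metis minus_minus)
      then show ?thesis by (intro exI[of _ i] exI[of _ "-1"]) simp
    qed
    then obtain \<sigma> \<epsilon> where \<sigma>: "\<And>j. \<epsilon> j \<in> {1, -1}" "\<And>j. h *v \<beta> j = \<epsilon> j *s \<beta> (\<sigma> j)"
      by metis
    have "inj \<sigma>"
    proof (rule injI)
      fix j k assume "\<sigma> j = \<sigma> k"
      then have "h *v \<beta> j = h *v ((\<epsilon> j * \<epsilon> k) *s \<beta> k)"
        using \<sigma>(1)[of k] unfolding matrix_mult_scale \<sigma>(2) by auto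
      then have "\<beta> j = (\<epsilon> j * \<epsilon> k) *s \<beta> k"
        using inj_matrix_vector_mult[OF inv[OF h]] by (metis injD)
      moreover have "\<epsilon> j * \<epsilon> k \<in> {1, -1}" using \<sigma>(1)[of j] \<sigma>(1)[of k] by auto
      ultimately show "j = k" by (rule \<beta>_inj)
    qed
    then have "bij \<sigma>" by (simp add: bij_def finite_UNIV_inj_surj)
    moreover have "matrix_inv X ** h ** X = monomial_matrix \<sigma> \<epsilon>"
      by (rule matrix_eq_on_axes)
        (simp add: matrix_vector_mul_assoc[symmetric] Xax \<sigma>(2) matrix_mult_scale Xb monomial_matrix_axis)
    ultimately show ?thesis using \<sigma> by blast
  qed
  show ?thesis
  proof (intro exI[of _ X] conjI ballI impI X)
    fix h assume h: "h \<in> H"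
    show "signed_permutation (matrix_inv X ** h ** X)"
      unfolding signed_permutation_iff_monomial using main[OF h] by blast
  next
    fix h assume h: "h \<in> H" and diag: "\<forall>t\<in>T. h *v t \<in> {t, - t}"
    obtain \<sigma> \<epsilon> where \<sigma>: "\<And>j. \<epsilon> j \<in> {1, -1}" "matrix_inv X ** h ** X = monomial_matrix \<sigma> \<epsilon>"
      "\<And>j. h *v \<beta> j = \<epsilon> j *s \<beta> (\<sigma> j)"
      using main[OF h] by blast
    have "\<sigma> j = j" for j
    proof -
      obtain s where "s \<in> {1, -1}" "h *v \<beta> j = s *s \<beta> j"
      proof (cases "h *v \<beta> j = \<beta> j")
        case True
        then show thesis by (intro that[of 1]) simp_all
      next
        case False
        then have "h *v \<beta> j = - \<beta> j" using bspec[OF diag \<beta>T[of j]] by blast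
        then show thesis by (intro that[of "-1"]) simp_all
      qed
      then have "s *s \<beta> j = \<epsilon> j *s \<beta> (\<sigma> j)"
        using \<sigma>(3)[of j] by simp
      then have "\<epsilon> j *s (s *s \<beta> j) = \<epsilon> j *s (\<epsilon> j *s \<beta> (\<sigma> j))"
        by (simp only:)
      moreover have "\<epsilon> j * \<epsilon> j = 1" using \<sigma>(1)[of j] by auto
      ultimately have "\<beta> (\<sigma> j) = (\<epsilon> j * s) *s \<beta> j"
        by (simp del: vec.scale_left_commute)
      moreover have "\<epsilon> j * s \<in> {1, -1}" using \<open>s \<in> {1, -1}\<close> \<sigma>(1)[of j] by auto
      ultimately show ?thesis by (rule \<beta>_inj)
    qed
    then have "\<sigma> = id" by auto
    moreover have "\<epsilon> j \<noteq> 0" for j using sign_nonzero[OF \<sigma>(1)] .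
    ultimately show "pattern (matrix_inv X ** h ** X) = mat 1"
      unfolding \<sigma>(2) by (simp add: pattern_monomial_matrix monomial_matrix_id)
  qed
qed

text \<open>The orbit of a common eigenvector \<open>v\<close> of \<open>A\<close> under \<open>H\<close> provides the basis. Vectors of the orbit that differ by more than a sign
have distinct weights because the weight of \<open>v\<close> has no stabilizer beyond \<open>A\<close>, and \<open>H\<close> is chosen to
meet \<open>A\<close> only in elements that act on \<open>v\<close> by a sign; so no scalars other than signs can occur.\<close>

lemma signed_form_of_derived_involutions:
  fixes G :: "(complex^'n^'n) set"
  assumes G: "subgroup G GL" and irr: "irreducible_matrices G"
    and invol: "\<And>J. J \<in> derived GL G \<Longrightarrow> matrix_involution J"
  obtains X :: "complex^'n^'n" and H where "invertible X" "signed_permutation_group H"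
    "commutative_pattern H" "(\<lambda>A. matrix_inv X ** A ** X) ` G \<subseteq> nonzero_multiples H"
proof -
  define K where "K = nonzero_multiples G"
  define D where "D = derived GL G"
  have GK: "G \<subseteq> K" unfolding K_def by (rule subset_nonzero_multiples)
  have K: "subgroup K GL" unfolding K_def by (rule subgroup_nonzero_multiples[OF G])
  have irrK: "irreducible_matrices K" by (rule irreducible_matrices_mono[OF irr GK])
  have invK: "invertible x" if "x \<in> K" for x
    using subgroup.mem_carrier[OF K that] by (simp add: carrier_GL)
  have D: "subgroup D GL" "D \<subseteq> K"
    unfolding D_def
    using GL.derived_is_subgroup[OF subgroup.subset[OF G]] GL.derived_incl[OF subset_refl G] GK by auto
  have commD: "x ** y ** inv\<^bsub>GL\<^esub> x ** inv\<^bsub>GL\<^esub> y \<in> D" if "x \<in> K" "y \<in> K" for x y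
    using commutator_nonzero_multiples_in_derived[OF G] that unfolding K_def D_def by blast
  have sqD: "x ** x = mat 1" if "x \<in> D" for x
    using invol that unfolding D_def matrix_involution_def by blast
  have abD: "x ** y = y ** x" if xy: "x \<in> D" "y \<in> D" for x y
  proof -
    have "x ** y \<in> D" using subgroup.m_closed[OF D(1) xy] by (simp add: mult_GL)
    from sqD[OF this] have "x ** (x ** y ** (x ** y)) ** y = x ** y" by simp
    moreover have "x ** (x ** y ** (x ** y)) ** y = (x ** x) ** y ** x ** (y ** y)"
      by (simp only: matrix_mul_assoc)
    ultimately show ?thesis using sqD[OF xy(1)] sqD[OF xy(2)] by simp
  qed
  obtain A v lam where A: "subgroup A GL" "D \<subseteq> A" "A \<subseteq> K"
    and abA: "\<And>x y. x \<in> A \<Longrightarrow> y \<in> A \<Longrightarrow> x ** y = y ** x"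
    and max: "\<And>g. g \<in> K \<Longrightarrow> (\<And>a. a \<in> A \<Longrightarrow> g ** a = a ** g) \<Longrightarrow> g \<in> A"
    and v: "v \<noteq> 0" and lam: "\<And>a. a \<in> A \<Longrightarrow> a *v v = lam a *s v"
    using self_centralizing_with_common_eigenvector[OF K D(2) abD] by blast
  have commA: "x ** y ** inv\<^bsub>GL\<^esub> x ** inv\<^bsub>GL\<^esub> y \<in> A" if "x \<in> K" "y \<in> K" for x y
    using commD[OF that] A(2) by blast
  have lam_eqI: "lam a = c" if "a \<in> A" "a *v v = c *s v" for a c
    using lam[OF that(1)] that(2) v by simp
  have lam_mult: "lam (a ** b) = lam a * lam b" if "a \<in> A" "b \<in> A" for a b
  proof (rule lam_eqI)
    show "a ** b \<in> A" using subgroup.m_closed[OF A(1) that] by (simp add: mult_GL)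
    show "(a ** b) *v v = (lam a * lam b) *s v"
      using that by (simp add: matrix_vector_mul_assoc[symmetric] lam matrix_mult_scale mult.commute)
  qed
  have scalA: "mat c \<in> A" if "c \<noteq> 0" for c
  proof (rule max)
    have "mat c ** mat 1 \<in> K"
      using that subgroup.one_closed[OF G] unfolding K_def nonzero_multiples_eq one_GL by blast
    then show "mat c \<in> K" by simp
  qed (rule scalar_matrix_commute)
  have lam_scal: "lam (mat c) = c" if "c \<noteq> 0" for c
    by (rule lam_eqI[OF scalA[OF that] scalar_matrix_vector])
  \<comment> \<open>\<open>B\<close> collects the elements of \<open>A\<close> that act on \<open>v\<close> by a sign; a scalar lies in it only if it
    is \<open>1\<close> or \<open>-1\<close>.\<close>
  define B where "B = {a \<in> A. lam a \<in> {1, -1}}"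
  have DB: "D \<subseteq> B"
  proof
    fix d assume d: "d \<in> D"
    then have "lam d * lam d = 1"
      using lam_mult[of d d] A(2) sqD[OF d] lam_scal[of 1] by auto
    then show "d \<in> B" using d A(2) unfolding B_def by (auto simp: square_eq_1_iff)
  qed
  have B: "subgroup B GL"
  proof (rule GL.subgroupI)
    show "B \<subseteq> carrier GL" using subgroup.subset[OF A(1)] unfolding B_def by blast
    show "B \<noteq> {}" using DB subgroup.one_closed[OF D(1)] by blast
    fix a assume a: "a \<in> B"
    then have aA: "a \<in> A" unfolding B_def by blast
    have "lam (inv\<^bsub>GL\<^esub> a) * lam a = 1"
      using lam_mult[OF subgroup.m_inv_closed[OF A(1) aA] aA] lam_scal[of 1]
        GL_invD(2)[OF invK[OF subsetD[OF A(3) aA]]] by simp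
    then show "inv\<^bsub>GL\<^esub> a \<in> B"
      using a subgroup.m_inv_closed[OF A(1) aA] unfolding B_def by (auto simp: minus_equation_iff[of _ 1])
    fix b assume b: "b \<in> B"
    then have bA: "b \<in> A" unfolding B_def by blast
    show "a \<otimes>\<^bsub>GL\<^esub> b \<in> B"
      using subgroup.m_closed[OF A(1) aA bA] lam_mult[OF aA bA] a b unfolding B_def mult_GL by auto
  qed
  have BK: "B \<subseteq> K" unfolding B_def using A(3) by blast
  obtain H where H: "subgroup H GL" "B \<subseteq> H" "H \<subseteq> K" "H \<inter> {mat c |c. c \<noteq> 0} \<subseteq> B"
    and HC: "\<And>g. g \<in> K \<Longrightarrow> \<exists>z\<in>{mat c |c. c \<noteq> 0}. \<exists>h\<in>H. g = z ** h"
  proof (rule GL.divisible_central_supplement[OF K B BK scalar_subgroup, unfolded mult_GL])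
    show "{mat c |c. c \<noteq> 0} \<subseteq> K" using scalA A(3) by blast
    show "x ** y = y ** x" if "x \<in> {mat c |c. c \<noteq> 0}" for x y :: "complex^'n^'n"
      using that scalar_matrix_commute by blast
    show "\<exists>d\<in>{mat c |c. c \<noteq> 0}. d [^]\<^bsub>GL\<^esub> k = z"
      if z: "z \<in> {mat c |c. c \<noteq> 0}" and k: "k > 0" for z :: "complex^'n^'n" and k :: nat
    proof -
      obtain c where "z = mat c" "c \<noteq> 0" using z by blast
      then show ?thesis using scalar_matrix_root[OF _ k, of c] by auto
    qed
    show "x ** y ** inv\<^bsub>GL\<^esub> x ** inv\<^bsub>GL\<^esub> y \<in> B" if "x \<in> K" "y \<in> K" for x y
      using commD[OF that] DB by blast
  qed blast
  have invH: "invertible h" if "h \<in> H" for h using that H(3) invK by blast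
  \<comment> \<open>Write \<open>a\<close> as its eigenvalue times an element of weight \<open>1\<close>; the latter is in \<open>H\<close>, hence so is
    the scalar, which must then be a sign.\<close>
  have HA: "lam a \<in> {1, -1}" if a: "a \<in> H" "a \<in> A" for a
  proof -
    define c where "c = lam a"
    have ia: "invertible a" by (rule invH[OF a(1)])
    have c: "c \<noteq> 0"
    proof
      assume "c = 0"
      then have "a *v v = a *v 0" using lam[OF a(2)] by (simp add: c_def)
      then show False using inj_matrix_vector_mult[OF ia] v by (metis injD)
    qed
    have sA: "mat (inverse c) \<in> A" using scalA c by simp
    define b where "b = mat (inverse c) ** a"
    have bA: "b \<in> A" using subgroup.m_closed[OF A(1) sA a(2)] by (simp add: mult_GL b_def)
    have "lam b = 1" using lam_mult[OF sA a(2)] lam_scal[of "inverse c"] c by (simp add: b_def c_def)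
    then have bH: "b \<in> H" using bA H(2) unfolding B_def by blast
    have "mat c ** b = a" using c by (simp add: b_def matrix_mul_assoc scalar_matrix_mult_scalar)
    then have "mat c = a ** inv\<^bsub>GL\<^esub> b"
      using GL_invD(1)[OF invH[OF bH]] by (metis matrix_mul_assoc matrix_mul_rid)
    then have "mat c \<in> H"
      using subgroup.m_closed[OF H(1) a(1) subgroup.m_inv_closed[OF H(1) bH]] by (simp add: mult_GL)
    then have "mat c \<in> B" using H(4) c by blast
    then show ?thesis unfolding B_def using lam_scal[OF c] by (simp add: c_def)
  qed
  \<comment> \<open>The orbit of \<open>v\<close> under \<open>H\<close> is the future basis together with its negatives.\<close>
  define E where "E = (\<lambda>h. h *v v) ` H"
  have E0: "0 \<notin> E"
  proof
    assume "0 \<in> E"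
    then obtain h where "h \<in> H" "h *v v = h *v 0" unfolding E_def by auto
    then show False using inj_matrix_vector_mult[OF invH] v by (metis injD)
  qed
  have HE: "h *v e \<in> E" if h: "h \<in> H" and e: "e \<in> E" for h e
  proof -
    obtain k where k: "k \<in> H" "e = k *v v" using e unfolding E_def by blast
    then show ?thesis
      using subgroup.m_closed[OF H(1) h k(1)]
      unfolding E_def by (auto simp: matrix_vector_mul_assoc mult_GL)
  qed
  have E_neg: "- e \<in> E" if "e \<in> E" for e
  proof -
    have "mat (-1) \<in> H"
      using scalA[of "-1"] lam_scal[of "-1"] H(2) unfolding B_def by auto
    from HE[OF this that] show ?thesis by (simp add: scalar_matrix_vector)
  qed
  have vE: "v \<in> E"
  proof -
    have "mat 1 *v v \<in> E"
      using subgroup.one_closed[OF H(1)] unfolding E_def one_GL by blast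
    then show ?thesis by simp
  qed
  have spanE: "vec.span E = UNIV"
  proof (rule irreducible_invariant_span[OF irr vE v])
    fix g e assume g: "g \<in> G" and e: "e \<in> E"
    obtain c h where "g = mat c ** h" "h \<in> H" using HC GK g by blast
    then have "g *v e = c *s (h *v e)"
      by (simp add: matrix_vector_mul_assoc[symmetric] scalar_matrix_vector)
    then show "g *v e \<in> vec.span E"
      using HE[OF \<open>h \<in> H\<close> e] by (simp add: vec.span_scale vec.span_base)
  qed
  obtain T where T: "T \<subseteq> E" "\<And>t. t \<in> T \<Longrightarrow> - t \<notin> T"
    and T_cover: "\<And>e. e \<in> E \<Longrightarrow> e \<in> T \<or> - e \<in> T"
    using signs_modulo_negation[OF E0] E_neg by metis
  have "E \<subseteq> vec.span T"
  proof
    fix e assume "e \<in> E"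
    then show "e \<in> vec.span T"
      using T_cover[of e] vec.span_base[of e T] vec.span_base[of "- e" T] vec.span_neg[of "- e" T] by auto
  qed
  then have spanT: "vec.span T = UNIV"
    using spanE vec.span_minimal[OF _ vec.subspace_span] by blast
  have "\<forall>t\<in>T. \<exists>h. h \<in> H \<and> t = h *v v" using T(1) unfolding E_def by blast
  then obtain r where r: "\<And>t. t \<in> T \<Longrightarrow> r t \<in> H" "\<And>t. t \<in> T \<Longrightarrow> t = r t *v v" by metis
  have conjA: "inv\<^bsub>GL\<^esub> g ** a ** g \<in> A" if "g \<in> K" "a \<in> A" for g a
    using GL.conjugate_in_commutator_closed[OF K A(1,3), unfolded mult_GL, OF commA that] .
  have eig: "a *v (h *v v) = lam (inv\<^bsub>GL\<^esub> h ** a ** h) *s (h *v v)" if h: "h \<in> H" and a: "a \<in> A" for h a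
  proof -
    have "h ** (inv\<^bsub>GL\<^esub> h ** a ** h) = (h ** inv\<^bsub>GL\<^esub> h) ** a ** h"
      by (simp only: matrix_mul_assoc)
    then have "a ** h = h ** (inv\<^bsub>GL\<^esub> h ** a ** h)"
      by (simp add: GL_invD(1)[OF invH[OF h]])
    then have "a *v (h *v v) = h *v ((inv\<^bsub>GL\<^esub> h ** a ** h) *v v)"
      by (simp only: matrix_vector_mul_assoc)
    also have "\<dots> = lam (inv\<^bsub>GL\<^esub> h ** a ** h) *s (h *v v)"
      using lam[OF conjA[OF subsetD[OF H(3) h] a]] by (simp add: matrix_mult_scale)
    finally show ?thesis .
  qed
  have indep: "vec.independent T"
  proof (rule independent_of_distinct_weights[where A = A and w = "\<lambda>t a. lam (inv\<^bsub>GL\<^esub> (r t) ** a ** r t)"])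
    show "t \<noteq> 0" if "t \<in> T" for t using that T(1) E0 by blast
    show "a *v t = lam (inv\<^bsub>GL\<^esub> (r t) ** a ** r t) *s t" if "t \<in> T" "a \<in> A" for t a
      using eig[OF r(1)[OF that(1)] that(2)] r(2)[OF that(1)] by simp
  next
    fix s t assume s: "s \<in> T" and t: "t \<in> T" and "s \<noteq> t"
    show "\<exists>a\<in>A. lam (inv\<^bsub>GL\<^esub> (r s) ** a ** r s) \<noteq> lam (inv\<^bsub>GL\<^esub> (r t) ** a ** r t)"
    proof (rule ccontr)
      assume "\<not> ?thesis"
      then have same: "lam (inv\<^bsub>GL\<^esub> (r s) ** a ** r s) = lam (inv\<^bsub>GL\<^esub> (r t) ** a ** r t)" if "a \<in> A" for a
        using that by blast
      note rs = r(1)[OF s] and rt = r(1)[OF t]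
      have rc: "r s \<in> carrier GL" "r t \<in> carrier GL"
        using subgroup.mem_carrier[OF H(1)] rs rt by auto
      \<comment> \<open>Equal weights mean that \<open>g\<close> stabilizes the weight of \<open>v\<close>; then \<open>g\<close> is in \<open>A\<close> and moves \<open>v\<close>
        only by a sign, so \<open>s\<close> and \<open>t\<close> agree up to sign.\<close>
      define g where "g = inv\<^bsub>GL\<^esub> (r t) ** r s"
      have gH: "g \<in> H"
        using subgroup.m_closed[OF H(1) subgroup.m_inv_closed[OF H(1) rt] rs] by (simp add: mult_GL g_def)
      have "g \<in> A"
      proof (rule weight_stabilizer_in_self_centralizing[OF K irrK A(1,3) abA max commA v lam])
        show "g \<in> K" using gH H(3) by blast
        fix a assume a: "a \<in> A"
        define b where "b = r t ** a ** inv\<^bsub>GL\<^esub> (r t)"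
        have "inv\<^bsub>GL\<^esub> (inv\<^bsub>GL\<^esub> (r t)) ** a ** inv\<^bsub>GL\<^esub> (r t) \<in> A"
          using conjA[OF subsetD[OF H(3) subgroup.m_inv_closed[OF H(1) rt]] a] .
        then have bA: "b \<in> A" using GL.inv_inv[OF rc(2)] by (simp add: b_def)
        have ac: "a \<in> carrier GL" using subgroup.mem_carrier[OF A(1) a] .
        have "inv\<^bsub>GL\<^esub> (r s) ** b ** r s = inv\<^bsub>GL\<^esub> g ** a ** g"
          using rc GL.inv_mult_group[OF GL.inv_closed[OF rc(2)] rc(1)]
          unfolding b_def g_def mult_GL by (simp add: matrix_mul_assoc)
        moreover have "inv\<^bsub>GL\<^esub> (r t) ** b ** r t = a"
        proof -
          have "inv\<^bsub>GL\<^esub> (r t) ** b ** r t = (inv\<^bsub>GL\<^esub> (r t) ** r t) ** a ** (inv\<^bsub>GL\<^esub> (r t) ** r t)"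
            unfolding b_def by (simp only: matrix_mul_assoc)
          then show ?thesis by (simp add: GL_invD(2)[OF invH[OF rt]])
        qed
        ultimately show "lam (inv\<^bsub>GL\<^esub> g ** a ** g) = lam a" using same[OF bA] by simp
      qed
      then have "lam g \<in> {1, -1}" and gv: "g *v v = lam g *s v"
        using HA[OF gH] lam by auto
      moreover have "r s = r t ** g"
        unfolding g_def by (simp add: matrix_mul_assoc GL_invD(1)[OF invH[OF rt]])
      then have "s = lam g *s t"
        using r(2)[OF s] r(2)[OF t] gv by (metis matrix_mult_scale matrix_vector_mul_assoc)
      ultimately have "s = t \<or> s = - t" by auto
      then show False using \<open>s \<noteq> t\<close> T(2)[OF t] s by auto
    qed
  qed
  have perm: "h *v t \<in> T \<or> - (h *v t) \<in> T" if "h \<in> H" "t \<in> T" for h t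
    using T_cover HE that T(1) by blast
  from signed_permutations_in_basis[of H T, OF invH indep spanT perm T(2)]
  obtain X :: "complex^'n^'n" where X: "invertible X"
    and signed: "\<And>h. h \<in> H \<Longrightarrow> signed_permutation (matrix_inv X ** h ** X)"
    and diag: "\<And>h. h \<in> H \<Longrightarrow> \<forall>t\<in>T. h *v t \<in> {t, - t} \<Longrightarrow> pattern (matrix_inv X ** h ** X) = mat 1"
    by auto
  define X' where "X' = matrix_inv X"
  have X'_inv: "X' = inv\<^bsub>GL\<^esub> X" unfolding X'_def using inv_GL[OF X] by simp
  have X'c: "X' \<in> carrier GL" and X'X: "inv\<^bsub>GL\<^esub> X' = X"
    unfolding X'_inv using X GL.inv_closed[of X] GL.inv_inv[of X] by (simp_all add: carrier_GL)
  define P where "P = (\<lambda>h. X' ** h ** X) ` H"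
  have P: "subgroup P GL"
    using GL.conjugate_subgroup[OF X'c H(1)] unfolding P_def mult_GL X'X .
  show thesis
  proof (rule that[OF X])
    show "signed_permutation_group P"
      unfolding signed_permutation_group_def using P signed by (auto simp: P_def X'_def)
    show "(\<lambda>A. matrix_inv X ** A ** X) ` G \<subseteq> nonzero_multiples P"
    proof
      fix y assume "y \<in> (\<lambda>A. matrix_inv X ** A ** X) ` G"
      then obtain g where g: "g \<in> G" "y = X' ** g ** X" unfolding X'_def by blast
      obtain c h where ch: "g = mat c ** h" "c \<noteq> 0" "h \<in> H" using HC GK g(1) by blast
      have "y = mat c ** (X' ** h ** X)"
        unfolding g(2) ch(1) scalar_matrix_left_commute by (simp only: matrix_mul_assoc)
      then show "y \<in> nonzero_multiples P"
        unfolding nonzero_multiples_eq P_def using ch(2,3) by blast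
    qed
    have "pattern p ** pattern q = pattern q ** pattern p" if pq: "p \<in> P" "q \<in> P" for p q
    proof -
      obtain h k where hk: "p = X' ** h ** X" "h \<in> H" "q = X' ** k ** X" "k \<in> H"
        using pq unfolding P_def by blast
      have c: "h \<in> carrier GL" "k \<in> carrier GL" using subgroup.mem_carrier[OF H(1)] hk by auto
      define d where "d = h ** k ** inv\<^bsub>GL\<^esub> h ** inv\<^bsub>GL\<^esub> k"
      have dD: "d \<in> D" unfolding d_def using commD hk H(3) by blast
      then have dH: "d \<in> H" using DB H(2) by blast
      \<comment> \<open>Conjugating \<open>d\<close> by an element of \<open>H\<close> stays in \<open>D\<close>, so \<open>d\<close> acts by signs on the whole basis.\<close>
      have "pattern (matrix_inv X ** d ** X) = mat 1"
      proof (rule diag[OF dH ballI])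
        fix t assume t: "t \<in> T"
        have "inv\<^bsub>GL\<^esub> (r t) ** d ** r t \<in> D"
          using GL.conjugate_in_commutator_closed[OF K D, unfolded mult_GL, OF commD subsetD[OF H(3) r(1)[OF t]] dD] .
        then have "lam (inv\<^bsub>GL\<^esub> (r t) ** d ** r t) \<in> {1, -1}" using DB unfolding B_def by blast
        moreover have "d *v t = lam (inv\<^bsub>GL\<^esub> (r t) ** d ** r t) *s t"
          using eig[OF r(1)[OF t], of d] r(2)[OF t] dD A(2) by auto
        ultimately show "d *v t \<in> {t, - t}" by auto
      qed
      then have pd: "pattern (X' ** d ** X) = mat 1" unfolding X'_def .
      define e where "e = X' ** d ** X"
      have e_comm: "e = p ** q ** inv\<^bsub>GL\<^esub> p ** inv\<^bsub>GL\<^esub> q"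
        using GL.conjugate_of_commutator[OF X'c c] unfolding mult_GL X'X e_def d_def hk(1,3) .
      have "e \<in> P" unfolding e_def P_def using dH by blast
      have pqc: "p \<in> carrier GL" "q \<in> carrier GL" using subgroup.mem_carrier[OF P] pq by auto
      have "p ** q = e ** (q ** p)"
        unfolding e_comm using GL.commutator_swap[OF pqc] by (simp add: mult_GL)
      moreover have sP: "signed_permutation x" if "x \<in> P" for x
        using that signed unfolding P_def X'_def by blast
      moreover have "q ** p \<in> P" using subgroup.m_closed[OF P pq(2,1)] by (simp add: mult_GL)
      ultimately show ?thesis
        using commutator_trivial_pattern_iff[OF sP[OF pq(1)] sP[OF pq(2)] sP[OF \<open>e \<in> P\<close>]] pd
        unfolding e_def by blast
    qed
    then show "commutative_pattern P" unfolding commutative_pattern_def by blast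
  qed
qed

theorem proposition3p2:
  fixes G :: "(complex^'n^'n) set"
  assumes "subgroup G GL"
    and "irreducible_matrices G"
  shows "(\<forall>J\<in>derived GL G. matrix_involution J) \<longleftrightarrow>
    (\<exists>(X :: complex^'n^'n) (H :: (complex^'n^'n) set).
       invertible X \<and> signed_permutation_group H \<and> commutative_pattern H \<and>
       (\<lambda>A. matrix_inv X ** A ** X) ` G \<subseteq> nonzero_multiples H)"
  (is "?L \<longleftrightarrow> ?R")
proof
  assume ?L
  then obtain X :: "complex^'n^'n" and H where "invertible X" "signed_permutation_group H"
    "commutative_pattern H" "(\<lambda>A. matrix_inv X ** A ** X) ` G \<subseteq> nonzero_multiples H"
    using signed_form_of_derived_involutions[OF assms] by blast
  then show ?R by blast
next
  assume ?R
  then show ?L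
    using derived_involutions_of_signed_form[OF assms(1)] by blast
qed

end
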